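(* Consider the causal adversarial multi-path network model described in the context, with $C$ unit-capacity links, additive jamming, no feedback, and with both reliability and perfect secrecy required. For any $\vec z=(z_{rw},z_{ro},z_{wo})$ with $z_{rw}+z_{ro}+z_{wo}\le C$, the maximum achievable reliable and secret rate is $$R^{add}_{j,s}(\vec z)=\begin{cases} \max\{0,\ C-(z_{wo}+z_{ro}+2z_{rw})\} & \text{if } z_{wo}+2z_{rw}<C,\\ 0 & \text{otherwise.}\end{cases}$$
   Context: Model. A sender (Alice) communicates with a receiver (Bob) over $C$ parallel directed noiseless links $L_1,\dots,L_C$, each of unit capacity (over $n$ time slots each link carries a length-$n$ word; large-alphabet regime). A code of block length $n$ and rate $R$ has message $M$ uniform on $\{0,1\}^{nR}$; the encoder is stochastic, using private randomness unknown to the adversary, and maps message and randomness to codewords $\vec X_i$ sent on $L_i$; the decoder maps received words $\vec Y_1,\dots,\vec Y_C$ to $\hat M$. No feedback: the encoder's output depends only on the message and Alice's randomness. Adversary. Calvin, who knows the encoder and decoder, selects pairwise disjoint link sets $Z_{rw},Z_{ro},Z_{wo}$ (unknown to Alice and Bob) with $|Z_{rw}|\le z_{rw}$, $|Z_{ro}|\le z_{ro}$, $|Z_{wo}|\le z_{wo}$; he reads the links in $Z_r=Z_{rw}\cup Z_{ro}$ and jams the links in $Z_w=Z_{rw}\cup Z_{wo}$. He is causal: his jamming of the $t$-th symbols may depend only on the first $t$ symbols observed on $Z_r$. Under additive jamming $\vec Y_i=\vec X_i+\vec E_i$ with $\vec E_i$ chosen by Calvin and $\vec E_i=0$ for $i\notin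 Z_w$; under overwrite jamming $\vec Y_i=\vec E_i$ for $i\in Z_w$ and $\vec Y_i=\vec X_i$ otherwise. Reliability and secrecy. Rate $R$ is achievable (reliably and secretly) if for every $\varepsilon>0$ and all sufficiently large $n$ there is a code of block length $n$ and rate $R$ such that $\Pr[\hat M\neq M]<\varepsilon$ against every admissible causal adversary and, for every set $Z_r$ of at most $z_{rw}+z_{ro}$ links, the mutual information $I(M;X_{Z_r})=0$, where $X_{Z_r}$ is the collection of codewords sent on the links in $Z_r$. The maximum achievable rate is the supremum of such $R$. *)

theory Defs
  imports "HOL-Probability.Probability" "HOL-Computational_Algebra.Primes"
begin

text \<open>Codeword/received word on the C links over n time slots:
  W i t = symbol on link i at time t (i < C, t < n), 0 outside that range.
  Alphabet: the field Z_p (symbols 0..p-1, addition mod p).\<close>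

type_synonym word = "nat \<Rightarrow> nat \<Rightarrow> nat"

definition restrict_links :: "nat set \<Rightarrow> word \<Rightarrow> word" where
  "restrict_links Z X = (\<lambda>i t. if i \<in> Z then X i t else 0)"

definition mutual_info :: "('a \<times> 'b) pmf \<Rightarrow> real" where
  "mutual_info J =
     (\<Sum>ab\<in>set_pmf J. pmf J ab *
        log 2 (pmf J ab / (pmf (map_pmf fst J) (fst ab) * pmf (map_pmf snd J) (snd ab))))"

definition msg_pmf :: "nat \<Rightarrow> nat pmf" where
  "msg_pmf K = pmf_of_set {0..<K}"

text \<open>Stochastic encoder enc: message m < K \<mapsto> distribution of the codeword (private
  randomness of Alice); decoder dec: received word \<mapsto> message estimate.\<close>
definition valid_code :: "nat \<Rightarrow> nat \<Rightarrow> nat \<Rightarrow> nat \<Rightarrow> (nat \<Rightarrow> word pmf) \<Rightarrow> bool" where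
  "valid_code p C n K enc \<longleftrightarrow> K \<ge> 1 \<and>
     (\<forall>m<K. \<forall>X\<in>set_pmf (enc m). \<forall>i t.
        (i < C \<and> t < n \<longrightarrow> X i t < p) \<and> (\<not> (i < C \<and> t < n) \<longrightarrow> X i t = 0))"

text \<open>A (deterministic, w.l.o.g.) causal additive adversary: link sets Zrw, Zro, Zwo and a
  jamming map E giving the error symbol E X i t; E vanishes off Z_w = Zrw \<union> Zwo and E X i t
  depends only on the symbols of X on Z_r = Zrw \<union> Zro at times s \<le> t.\<close>
definition admissible_adv ::
  "nat \<Rightarrow> nat \<Rightarrow> nat \<Rightarrow> nat \<Rightarrow> nat set \<Rightarrow> nat set \<Rightarrow> nat set \<Rightarrow> (word \<Rightarrow> word) \<Rightarrow> bool" where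
  "admissible_adv C zrw zro zwo Zrw Zro Zwo E \<longleftrightarrow>
     Zrw \<union> Zro \<union> Zwo \<subseteq> {..<C} \<and>
     Zrw \<inter> Zro = {} \<and> Zrw \<inter> Zwo = {} \<and> Zro \<inter> Zwo = {} \<and>
     card Zrw \<le> zrw \<and> card Zro \<le> zro \<and> card Zwo \<le> zwo \<and>
     (\<forall>X i t. i \<notin> Zrw \<union> Zwo \<longrightarrow> E X i t = 0) \<and>
     (\<forall>X X' t. (\<forall>i\<in>Zrw \<union> Zro. \<forall>s\<le>t. X i s = X' i s) \<longrightarrow> (\<forall>i. E X i t = E X' i t))"

definition received_add :: "nat \<Rightarrow> nat \<Rightarrow> nat \<Rightarrow> (word \<Rightarrow> word) \<Rightarrow> word \<Rightarrow> word" where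
  "received_add p C n E X = (\<lambda>i t. if i < C \<and> t < n then (X i t + E X i t) mod p else 0)"

definition error_prob_add ::
  "nat \<Rightarrow> nat \<Rightarrow> nat \<Rightarrow> nat \<Rightarrow> (nat \<Rightarrow> word pmf) \<Rightarrow> (word \<Rightarrow> nat) \<Rightarrow> (word \<Rightarrow> word) \<Rightarrow> real" where
  "error_prob_add p C n K enc dec E =
     measure_pmf.prob (msg_pmf K \<bind> (\<lambda>m. map_pmf (\<lambda>X. (m, X)) (enc m)))
       {(m, X). dec (received_add p C n E X) \<noteq> m}"

definition secret :: "nat \<Rightarrow> nat \<Rightarrow> nat \<Rightarrow> (nat \<Rightarrow> word pmf) \<Rightarrow> bool" where
  "secret C zr K enc \<longleftrightarrow>
     (\<forall>Zr. Zr \<subseteq> {..<C} \<and> card Zr \<le> zr \<longrightarrow>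
        mutual_info (msg_pmf K \<bind> (\<lambda>m. map_pmf (\<lambda>X. (m, restrict_links Zr X)) (enc m))) = 0)"

definition achievable_add :: "nat \<Rightarrow> nat \<Rightarrow> nat \<Rightarrow> nat \<Rightarrow> real \<Rightarrow> bool" where
  "achievable_add C zrw zro zwo R \<longleftrightarrow>
     (\<forall>\<epsilon>>0. \<exists>p0. \<forall>p\<ge>p0. prime p \<longrightarrow>
        (\<exists>N. \<forall>n\<ge>N. \<exists>K enc dec.
           real K \<ge> real p powr (real n * R) \<and>
           valid_code p C n K enc \<and>
           (\<forall>Zrw Zro Zwo E. admissible_adv C zrw zro zwo Zrw Zro Zwo E \<longrightarrow>
              error_prob_add p C n K enc dec E < \<epsilon>) \<and>
           secret C (zrw + zro) K enc))"

end

theory Submission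
  imports Defs "HOL-Number_Theory.Cong" "HOL-Real_Asymp.Real_Asymp"
begin

text \<open>
  Write \<open>z\<^sub>r = z\<^sub>r\<^sub>w + z\<^sub>r\<^sub>o\<close> and \<open>z\<^sub>w = z\<^sub>r\<^sub>w + z\<^sub>w\<^sub>o\<close>. The claimed value is \<open>max 0 (C - z\<^sub>w - z\<^sub>r)\<close> in
  both cases.

  Converse: Calvin adds a fixed noise on \<open>z\<^sub>w\<close> links. Averaged over all noises, these links carry
  nothing, and by secrecy another \<open>z\<^sub>r\<close> links are independent of the message, so at most
  \<open>C - z\<^sub>w - z\<^sub>r\<close> links help Bob.

  Achievability: the payload is shared by polynomials of degree less than \<open>C - z\<^sub>w\<close>, with \<open>z\<^sub>r\<close> random
  coefficients. Every ordered pair of links \<open>(j, i)\<close>, including \<open>j = i\<close>, is equipped with a masked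
  linear hash: link \<open>j\<close> carries key and mask, link \<open>i\<close> carries the tag of its payload. If \<open>j\<close> is not
  read, then a modified payload on \<open>i\<close> passes the test of \<open>j\<close> with probability at most \<open>1/p\<close>, even if
  \<open>j\<close> itself is jammed. So modified payloads are verified by at most \<open>z\<^sub>r\<close> links, whereas untouched
  links are verified by at least \<open>C - z\<^sub>w > z\<^sub>r\<close> links. Bob keeps the links verified more than \<open>z\<^sub>r\<close> times
  and interpolates. A payload that is an \<open>s \<times> s\<close> block needs keys and tags of length \<open>O(s)\<close>
  only, so the rate loss vanishes.
\<close>

section \<open>Counting words\<close>

definition words_on :: "nat \<Rightarrow> nat set \<Rightarrow> nat \<Rightarrow> word set" where
  "words_on p A n =
     {X. \<forall>i t. (i \<in> A \<and> t < n \<longrightarrow> X i t < p) \<and> (\<not> (i \<in> A \<and> t < n) \<longrightarrow> X i t = 0)}"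

lemma words_on_bij:
  "bij_betw case_prod (words_on p A n) (PiE_dflt (A \<times> {..<n}) 0 (\<lambda>_. {..<p}))"
  by (rule bij_betwI[where g = curry])
    (auto simp: words_on_def PiE_dflt_def curry_def fun_eq_iff)

lemma card_words_on: "finite A \<Longrightarrow> card (words_on p A n) = p ^ (n * card A)"
  using bij_betw_same_card[OF words_on_bij, of p A n]
  by (simp add: card_PiE_dflt card_cartesian_product mult.commute)

lemma finite_words_on: "finite A \<Longrightarrow> finite (words_on p A n)"
  using bij_betw_finite[OF words_on_bij, of p A n] by (simp add: finite_PiE_dflt)

section \<open>Mutual information and the converse\<close>

text \<open>Equality case of Gibbs' inequality: mutual information is a relative entropy, and
  \<open>ln t \<le> t - 1\<close> is tight only at \<open>t = 1\<close>. The conclusion concerns the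
  support of \<open>J\<close>.\<close>

lemma mutual_info_zero_imp_independent:
  assumes fin: "finite (set_pmf J)" and zero: "mutual_info J = 0" and ab: "ab \<in> set_pmf J"
  shows "pmf J ab = pmf (map_pmf fst J) (fst ab) * pmf (map_pmf snd J) (snd ab)"
proof -
  define q where "q x = pmf (map_pmf fst J) (fst x) * pmf (map_pmf snd J) (snd x)" for x
  have q_pair: "q x = pmf (pair_pmf (map_pmf fst J) (map_pmf snd J)) x" for x
    by (cases x) (simp add: q_def pmf_pair)
  have p_pos: "pmf J x > 0" if "x \<in> set_pmf J" for x
    using that by (simp add: pmf_positive)
  have q_pos: "q x > 0" if "x \<in> set_pmf J" for x
    using that unfolding q_def by (auto intro!: mult_pos_pos pmf_positive)
  \<comment> \<open>Subtracting \<open>pmf J x - q x\<close> makes each summand nonnegative, and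
    these differences sum to at least 0 over the support. Zero mutual information thus forces every
    \<open>d x\<close> to vanish.\<close>
  define d where "d x = pmf J x * ln (pmf J x / q x) - (pmf J x - q x)" for x
  have d_alt: "d x = pmf J x * ((q x / pmf J x - 1) - ln (q x / pmf J x))" if "x \<in> set_pmf J" for x
    using p_pos[OF that] q_pos[OF that] by (simp add: d_def ln_div field_simps)
  have d_nonneg: "d x \<ge> 0" if "x \<in> set_pmf J" for x
    using p_pos[OF that] q_pos[OF that] ln_le_minus_one[of "q x / pmf J x"]
    by (simp add: d_alt[OF that])
  have "(\<Sum>x\<in>set_pmf J. pmf J x * ln (pmf J x / q x)) = mutual_info J * ln 2"
    by (simp add: mutual_info_def q_def log_def sum_distrib_right)
  moreover have "(\<Sum>x\<in>set_pmf J. pmf J x) = 1"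
    by (rule sum_pmf_eq_1) (use fin in auto)
  moreover have "(\<Sum>x\<in>set_pmf J. q x) \<le> 1"
    unfolding q_pair using measure_pmf.prob_le_1 by (simp add: fin flip: measure_measure_pmf_finite)
  ultimately have "(\<Sum>x\<in>set_pmf J. d x) \<le> 0"
    using zero by (simp add: d_def sum_subtractf)
  then have "d ab = 0"
    using sum_nonneg_eq_0_iff[OF fin, of d] d_nonneg ab sum_nonneg[of "set_pmf J" d] by force
  then have "ln (q ab / pmf J ab) = q ab / pmf J ab - 1"
    using p_pos[OF ab] by (simp add: d_alt[OF ab])
  then have "q ab / pmf J ab = 1"
    using p_pos[OF ab] q_pos[OF ab] by (intro ln_eq_minus_one) auto
  then show ?thesis
    using p_pos[OF ab] by (simp add: q_def)
qed

lemma mutual_info_pair_pmf: "mutual_info (pair_pmf P Q) = 0"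
proof -
  have "pmf (pair_pmf P Q) ab *
      log 2 (pmf (pair_pmf P Q) ab / (pmf P (fst ab) * pmf Q (snd ab))) = 0" for ab
    by (cases ab) (simp add: pmf_pair)
  then show ?thesis
    unfolding mutual_info_def map_fst_pair_pmf map_snd_pair_pmf by (intro sum.neutral) blast
qed

text \<open>Averaging over all constant noises on the jammed links makes what Bob receives there
  useless, and the links \<open>S\<close> say nothing about the message, so only the remaining links count.\<close>
lemma secret_code_size_bound:
  assumes le: "zrw + zro + zwo \<le> C" and p: "p \<ge> 1"
    and valid: "valid_code p C n K enc" and secret: "secret C (zrw + zro) K enc"
    and rel: "\<And>Zrw Zro Zwo E. admissible_adv C zrw zro zwo Zrw Zro Zwo E \<Longrightarrow>
                error_prob_add p C n K enc dec E < 1 / 2"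
  shows "real K < 2 * real p ^ (n * (C - (zwo + zro + 2 * zrw)))"
proof -
  define zw where "zw = zrw + zwo"
  define W where "W = {..<zw}"
  \<comment> \<open>The \<open>min\<close> matters when \<open>zw + zrw + zro\<close> exceeds
    \<open>C\<close>: then \<open>S\<close> consists of all links outside \<open>W\<close>, in
    accordance with the truncated subtraction in the bound.\<close>
  define S where "S = {zw..<min C (zw + (zrw + zro))}"
  have zw: "zw \<le> C" using le by (simp add: zw_def)
  have S: "S \<subseteq> {..<C}" "card S \<le> zrw + zro" "finite S" "S \<inter> W = {}"
    by (auto simp: S_def W_def)
  have card_S: "C - card S - zw = C - (zwo + zro + 2 * zrw)" "zw + card S \<le> C"
    using zw by (auto simp: S_def zw_def)
  define N where "N = words_on p W n"
  have card_N: "card N = p ^ (n * zw)" and fin_N: "finite N"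
    by (auto simp: N_def W_def card_words_on finite_words_on)
  define V where "V = words_on p {..<C} n"
  have fin_V: "finite V" by (simp add: V_def finite_words_on)
  have enc: "set_pmf (enc m) \<subseteq> V" if "m < K" for m
    using valid that by (auto simp: valid_code_def V_def words_on_def)
  have K: "K \<ge> 1" using valid by (simp add: valid_code_def)
  have set_msg: "set_pmf (msg_pmf K) = {0..<K}"
    using K by (simp add: msg_pmf_def)
  define J where "J = msg_pmf K \<bind> (\<lambda>m. map_pmf (\<lambda>X. (m, X)) (enc m))"
  define J' where "J' = map_pmf (\<lambda>(m, X). (m, restrict_links S X)) J"
  have set_J: "set_pmf J \<subseteq> {0..<K} \<times> V"
    using enc by (fastforce simp: J_def set_msg)
  have fin_J: "finite (set_pmf J)"
    by (rule finite_subset[OF set_J]) (simp add: fin_V)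
  have J'_alt: "J' = msg_pmf K \<bind> (\<lambda>m. map_pmf (\<lambda>X. (m, restrict_links S X)) (enc m))"
    by (simp add: J'_def J_def map_bind_pmf pmf.map_comp o_def)
  have "mutual_info J' = 0"
    using secret S unfolding secret_def J'_alt by blast
  have fin_J': "finite (set_pmf J')"
    using fin_J by (simp add: J'_def)
  have fst_J': "map_pmf fst J' = msg_pmf K"
    by (simp add: J'_alt map_bind_pmf pmf.map_comp o_def map_pmf_const bind_return_pmf')
  define Q where "Q = map_pmf snd J'"
  have fin_Q: "finite (set_pmf Q)" using fin_J' by (simp add: Q_def)
  \<comment> \<open>Off the support of \<open>J'\<close> the left side is 0, so independence on the
    support is enough for this inequality.\<close>
  have indep: "pmf J' (m, w) \<le> 1 / K * pmf Q w" if "m < K" for m w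
  proof (cases "(m, w) \<in> set_pmf J'")
    case True
    show ?thesis
      using mutual_info_zero_imp_independent[OF fin_J' \<open>mutual_info J' = 0\<close> True] that K
      by (simp add: fst_J' Q_def msg_pmf_def)
  next
    case False
    then have "pmf J' (m, w) = 0" by (simp add: set_pmf_iff)
    then show ?thesis by simp
  qed
  define G where "G m w = {Y \<in> V. restrict_links S Y = w \<and> dec Y = m}" for m w
  have fin_G: "finite (G m w)" for m w by (simp add: G_def fin_V)
  \<comment> \<open>For fixed \<open>w\<close> the sets are disjoint, and a word in one of them is
    determined by its symbols outside \<open>S\<close>.\<close>
  have sum_G: "(\<Sum>m<K. card (G m w)) \<le> p ^ (n * (C - card S))" for w
  proof -
    have "(\<Sum>m<K. card (G m w)) = card (\<Union>m<K. G m w)"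
      by (intro card_UN_disjoint[symmetric] ballI impI fin_G) (auto simp: G_def)
    also have "\<dots> \<le> card (words_on p ({..<C} - S) n)"
    proof (rule card_inj_on_le)
      show "inj_on (restrict_links ({..<C} - S)) (\<Union>m<K. G m w)"
      proof (rule inj_onI, intro ext)
        fix X Y i t
        assume XY: "X \<in> (\<Union>m<K. G m w)" "Y \<in> (\<Union>m<K. G m w)"
          "restrict_links ({..<C} - S) X = restrict_links ({..<C} - S) Y"
        then have "restrict_links S X i t = restrict_links S Y i t"
          "restrict_links ({..<C} - S) X i t = restrict_links ({..<C} - S) Y i t"
          by (auto simp: G_def)
        then show "X i t = Y i t"
          using XY(1,2) by (cases "i < C") (auto simp: restrict_links_def G_def V_def words_on_def split: if_splits)
      qed
      show "restrict_links ({..<C} - S) ` (\<Union>m<K. G m w) \<subseteq> words_on p ({..<C} - S) n"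
        by (auto simp: restrict_links_def G_def V_def words_on_def)
    qed (simp add: finite_words_on)
    also have "\<dots> = p ^ (n * (C - card S))"
      using S by (simp add: card_words_on card_Diff_subset)
    finally show ?thesis .
  qed
  define hit where "hit e = {(m, X). dec (received_add p C n (\<lambda>_. e) X) = m}" for e
  have prob_hit: "measure_pmf.prob J (hit e) > 1 / 2" if "e \<in> N" for e
  proof -
    \<comment> \<open>A constant noise ignores everything read, hence is causal; the
      \<open>zw\<close> jammed links split into \<open>zrw\<close> and \<open>zwo\<close>
      links.\<close>
    have "admissible_adv C zrw zro zwo {..<zrw} {} {zrw..<zw} (\<lambda>_. e)"
      using zw that by (auto simp: admissible_adv_def zw_def N_def W_def words_on_def)
    then have "error_prob_add p C n K enc dec (\<lambda>_. e) < 1 / 2" by (rule rel)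
    moreover have "error_prob_add p C n K enc dec (\<lambda>_. e) = measure_pmf.prob J (UNIV - hit e)"
      unfolding error_prob_add_def J_def hit_def by (rule arg_cong2[where f = measure]) auto
    moreover have "measure_pmf.prob J (UNIV - hit e) = 1 - measure_pmf.prob J (hit e)"
      using measure_pmf.prob_compl[of "hit e" J] by simp
    ultimately show ?thesis by simp
  qed
  \<comment> \<open>Distinct noises give distinct received words, and noise supported on
    \<open>W\<close> leaves the symbols on \<open>S\<close> intact.\<close>
  have count: "card {e \<in> N. (m, X) \<in> hit e} \<le> card (G m (restrict_links S X))"
    if "X \<in> V" for m X
  proof (rule card_inj_on_le[where f = "\<lambda>e. received_add p C n (\<lambda>_. e) X"])
    show "inj_on (\<lambda>e. received_add p C n (\<lambda>_. e) X) {e \<in> N. (m, X) \<in> hit e}"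
    proof (rule inj_onI, intro ext)
      fix e e' i t
      assume e: "e \<in> {e \<in> N. (m, X) \<in> hit e}" "e' \<in> {e \<in> N. (m, X) \<in> hit e}"
        and eq: "received_add p C n (\<lambda>_. e) X = received_add p C n (\<lambda>_. e') X"
      show "e i t = e' i t"
      proof (cases "i < zw \<and> t < n")
        case True
        then have "(X i t + e i t) mod p = (X i t + e' i t) mod p"
          using fun_cong[OF fun_cong[OF eq, of i], of t] zw by (auto simp: received_add_def)
        then have "[e i t = e' i t] (mod p)"
          using cong_add_lcancel_nat unfolding cong_def by blast
        moreover have "e i t < p" "e' i t < p"
          using e True by (auto simp: N_def W_def words_on_def)
        ultimately show ?thesis by (simp add: cong_def)
      next
        case False
        then show ?thesis using e by (auto simp: N_def W_def words_on_def)
      qed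
    qed
    show "(\<lambda>e. received_add p C n (\<lambda>_. e) X) ` {e \<in> N. (m, X) \<in> hit e} \<subseteq> G m (restrict_links S X)"
    proof safe
      fix e assume e: "e \<in> N" "(m, X) \<in> hit e"
      have "restrict_links S (received_add p C n (\<lambda>_. e) X) i t = restrict_links S X i t" for i t
      proof (cases "i \<in> S \<and> t < n")
        case True
        then have "i \<notin> W" "i < C" using S by auto
        then have "e i t = 0" "X i t < p"
          using e that True by (auto simp: N_def words_on_def V_def)
        then show ?thesis using True \<open>i < C\<close> by (simp add: restrict_links_def received_add_def)
      next
        case False
        then show ?thesis
          using that by (auto simp: restrict_links_def received_add_def V_def words_on_def)
      qed
      then show "received_add p C n (\<lambda>_. e) X \<in> G m (restrict_links S X)"
        using e p by (auto simp: G_def hit_def V_def words_on_def received_add_def)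
    qed
  qed (rule fin_G)
  \<comment> \<open>Double counting: the success probabilities, summed over all noises, give the
    expected number of noises under which decoding succeeds. \<open>count\<close> bounds this number
    through the view on \<open>S\<close>, \<open>indep\<close> decouples that view from the message,
    and \<open>sum_G\<close> sums over the messages.\<close>
  have "card N * (1 / 2) < (\<Sum>e\<in>N. measure_pmf.prob J (hit e))"
  proof -
    have "N \<noteq> {}" using card_N p by force
    then have "(\<Sum>e\<in>N. 1 / 2) < (\<Sum>e\<in>N. measure_pmf.prob J (hit e))"
      using prob_hit fin_N by (intro sum_strict_mono) auto
    then show ?thesis by simp
  qed
  also have "\<dots> = (\<Sum>e\<in>N. \<Sum>x\<in>set_pmf J. pmf J x * of_bool (x \<in> hit e))"
  proof (rule sum.cong[OF refl])
    fix e
    have "measure_pmf.prob J (hit e) = measure_pmf.prob J (set_pmf J \<inter> hit e)"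
      by (metis Int_commute measure_Int_set_pmf)
    also have "\<dots> = (\<Sum>x\<in>set_pmf J \<inter> hit e. pmf J x)"
      using fin_J by (simp add: measure_measure_pmf_finite)
    also have "\<dots> = (\<Sum>x\<in>set_pmf J. pmf J x * of_bool (x \<in> hit e))"
      using fin_J by (simp add: of_bool_def if_distrib sum.If_cases cong: if_cong)
    finally show "measure_pmf.prob J (hit e) = (\<Sum>x\<in>set_pmf J. pmf J x * of_bool (x \<in> hit e))" .
  qed
  also have "\<dots> = (\<Sum>x\<in>set_pmf J. pmf J x * (\<Sum>e\<in>N. of_bool (x \<in> hit e)))"
    by (subst sum.swap) (simp add: sum_distrib_left)
  also have "\<dots> = (\<Sum>x\<in>set_pmf J. pmf J x * card {e \<in> N. x \<in> hit e})"
    using fin_N by (simp add: of_bool_def sum.If_cases Int_def)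
  also have "\<dots> \<le> (\<Sum>x\<in>set_pmf J. pmf J x * (case x of (m, X) \<Rightarrow> card (G m (restrict_links S X))))"
    using set_J count by (intro sum_mono mult_left_mono) auto
  also have "\<dots> = (\<integral>x. (case x of (m, X) \<Rightarrow> real (card (G m (restrict_links S X)))) \<partial>measure_pmf J)"
    by (subst integral_measure_pmf_real[OF fin_J]) (auto intro!: sum.cong)
  also have "\<dots> = (\<integral>x. (case x of (m, w) \<Rightarrow> real (card (G m w))) \<partial>measure_pmf J')"
    by (simp add: J'_def case_prod_unfold)
  also have "\<dots> = (\<Sum>x\<in>{..<K} \<times> set_pmf Q. (case x of (m, w) \<Rightarrow> real (card (G m w))) * pmf J' x)"
  proof (rule integral_measure_pmf_real)
    fix x assume "x \<in> set_pmf J'"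
    then show "x \<in> {..<K} \<times> set_pmf Q"
      using set_J by (force simp: J'_def Q_def)
  qed (use fin_Q in auto)
  also have "\<dots> = (\<Sum>m<K. \<Sum>w\<in>set_pmf Q. card (G m w) * pmf J' (m, w))"
    by (simp add: sum.cartesian_product case_prod_unfold)
  also have "\<dots> \<le> (\<Sum>m<K. \<Sum>w\<in>set_pmf Q. card (G m w) * (1 / K * pmf Q w))"
    using indep by (intro sum_mono mult_left_mono) auto
  also have "\<dots> = (\<Sum>w\<in>set_pmf Q. (1 / K * pmf Q w) * real (\<Sum>m<K. card (G m w)))"
    by (subst sum.swap) (simp add: sum_distrib_left mult.commute)
  also have "\<dots> \<le> (\<Sum>w\<in>set_pmf Q. (1 / K * pmf Q w) * real (p ^ (n * (C - card S))))"
    using sum_G by (intro sum_mono mult_left_mono) (auto simp only: of_nat_le_iff, auto)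
  also have "\<dots> = (\<Sum>w\<in>set_pmf Q. pmf Q w) * (real p ^ (n * (C - card S)) / K)"
    by (simp add: sum_distrib_right sum_divide_distrib)
  also have "(\<Sum>w\<in>set_pmf Q. pmf Q w) = 1"
    by (rule sum_pmf_eq_1) (use fin_Q in auto)
  finally have "real p ^ (n * zw) / 2 < real p ^ (n * (C - card S)) / K"
    by (simp add: card_N)
  moreover have "n * (C - card S) = n * zw + n * (C - (zwo + zro + 2 * zrw))"
    unfolding add_mult_distrib2[symmetric] using card_S by (intro arg_cong[where f = "(*) n"]) linarith
  ultimately have "real p ^ (n * zw) * (real K / 2) < real p ^ (n * zw) * real p ^ (n * (C - (zwo + zro + 2 * zrw)))"
    using K by (simp add: field_simps power_add)
  then show ?thesis
    using p by simp
qed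

text \<open>If \<open>R\<close> exceeded \<open>d\<close>, then \<open>p powr (n * (R - d))\<close>
  would be at least 2 once \<open>n * (R - d) \<ge> 1\<close>, against the size bound for codes with
  error probability below 1/2.\<close>

lemma achievable_le:
  assumes le: "zrw + zro + zwo \<le> C" and ach: "achievable_add C zrw zro zwo R"
  shows "R \<le> real (C - (zwo + zro + 2 * zrw))"
proof (rule ccontr)
  define d where "d = C - (zwo + zro + 2 * zrw)"
  assume "\<not> R \<le> real (C - (zwo + zro + 2 * zrw))"
  then have R: "R - real d > 0" by (simp add: d_def)
  obtain p0 where p0: "\<And>p. p \<ge> p0 \<Longrightarrow> prime p \<Longrightarrow>
        (\<exists>N. \<forall>n\<ge>N. \<exists>K enc dec.
           real K \<ge> real p powr (real n * R) \<and>
           valid_code p C n K enc \<and>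
           (\<forall>Zrw Zro Zwo E. admissible_adv C zrw zro zwo Zrw Zro Zwo E \<longrightarrow>
              error_prob_add p C n K enc dec E < 1 / 2) \<and>
           secret C (zrw + zro) K enc)"
    using ach unfolding achievable_add_def by (metis half_gt_zero_iff zero_less_one)
  obtain p where p: "prime p" "p > p0" using bigger_prime by blast
  have p2: "p \<ge> 2" using p prime_ge_2_nat by blast
  obtain N where N: "\<And>n. n \<ge> N \<Longrightarrow> \<exists>K enc dec.
           real K \<ge> real p powr (real n * R) \<and>
           valid_code p C n K enc \<and>
           (\<forall>Zrw Zro Zwo E. admissible_adv C zrw zro zwo Zrw Zro Zwo E \<longrightarrow>
              error_prob_add p C n K enc dec E < 1 / 2) \<and>
           secret C (zrw + zro) K enc"
    using p0[of p] p by (meson less_imp_le)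
  obtain n0 :: nat where "real n0 * (R - d) > 1"
    using R reals_Archimedean3[of "R - d"] by blast
  define n where "n = max N n0"
  have n: "n \<ge> N" "real n * (R - d) \<ge> 1"
  proof -
    have "real n0 * (R - d) \<le> real n * (R - d)"
      using R by (intro mult_right_mono) (auto simp: n_def)
    then show "real n * (R - d) \<ge> 1" using \<open>real n0 * (R - d) > 1\<close> by simp
  qed (simp add: n_def)
  obtain K enc dec where
    K: "real K \<ge> real p powr (real n * R)" and code: "valid_code p C n K enc"
      "secret C (zrw + zro) K enc"
    and rel: "\<And>Zrw Zro Zwo E. admissible_adv C zrw zro zwo Zrw Zro Zwo E \<Longrightarrow>
              error_prob_add p C n K enc dec E < 1 / 2"
    using N[OF n(1)] by blast
  have "2 * real p powr (real n * d) \<le> real p powr (real n * (R - d)) * real p powr (real n * d)"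
  proof (rule mult_right_mono)
    have "2 \<le> real p powr 1" using p2 by simp
    also have "\<dots> \<le> real p powr (real n * (R - d))" using p2 n by (intro powr_mono) auto
    finally show "2 \<le> real p powr (real n * (R - d))" .
  qed simp
  also have "\<dots> = real p powr (real n * R)"
    by (simp add: algebra_simps flip: powr_add)
  also have "\<dots> \<le> real K" by (rule K)
  also have "\<dots> < 2 * real p ^ (n * d)"
    unfolding d_def using le p2 code rel by (intro secret_code_size_bound) auto
  also have "\<dots> = 2 * real p powr (real n * d)"
    using p2 by (simp flip: powr_realpow)
  finally show False by simp
qed

section \<open>Polynomials modulo a prime\<close>

text \<open>The root bound over the field of \<open>p\<close> elements, phrased with integer
  polynomials and congruences. A linear factor for \<open>i\<close> is split off by synthetic
  division, and \<open>j - i\<close> is a unit modulo \<open>p\<close> for the other points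
  \<open>j\<close>. Bounding coefficients rather than the degree covers empty \<open>A\<close>,
  where \<open>P = 0\<close>.\<close>

lemma vanishing_poly_cong_0:
  fixes P :: "int poly"
  assumes "prime p" "A \<subseteq> {..<p}" "\<And>k. k \<ge> card A \<Longrightarrow> coeff P k = 0"
    and "\<And>i. i \<in> A \<Longrightarrow> [poly P (int i) = 0] (mod int p)"
  shows "[coeff P k = 0] (mod int p)"
proof -
  have "finite A" using assms(2) finite_subset by blast
  then show ?thesis using assms(2-4)
  proof (induction A arbitrary: P k rule: finite_induct)
    case empty
    then show ?case by simp
  next
    case (insert i A)
    define Q where "Q = synthetic_div P (int i)"
    have P: "P = [:- int i, 1:] * Q + [:poly P (int i):]"
      using synthetic_div_correct'[of "int i" P] by (simp add: Q_def)
    have "[coeff Q k = 0] (mod int p)" for k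
    proof (rule insert.IH)
      show "A \<subseteq> {..<p}" using insert.prems by simp
      have "degree P \<le> card A"
        using insert.prems(2) insert.hyps by (intro degree_le) auto
      then show "coeff Q k = 0" if "k \<ge> card A" for k
        using that by (cases "degree P = 0")
          (simp_all add: Q_def coeff_eq_0 degree_synthetic_div synthetic_div_eq_0_iff[THEN iffD2])
      show "[poly Q (int j) = 0] (mod int p)" if "j \<in> A" for j
      proof -
        have "poly P (int j) = (int j - int i) * poly Q (int j) + poly P (int i)"
          using arg_cong[OF P, of "\<lambda>P. poly P (int j)"] by (simp add: algebra_simps)
        then have "int p dvd (int j - int i) * poly Q (int j)"
          using insert.prems(3)[of i] insert.prems(3)[of j] that
          by (simp add: cong_0_iff dvd_add_left_iff)
        moreover have "\<not> int p dvd int j - int i"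
        proof
          assume "int p dvd int j - int i"
          then have "[j = i] (mod p)" by (simp add: cong_iff_dvd_diff flip: cong_int_iff)
          moreover have "j < p" "i < p" using insert.prems(1) that by auto
          ultimately have "j = i" by (simp add: cong_def)
          then show False using that insert.hyps by simp
        qed
        ultimately show ?thesis
          using \<open>prime p\<close> by (simp add: cong_0_iff prime_dvd_mult_iff)
      qed
    qed
    then have Q: "int p dvd coeff Q k" for k by (simp add: cong_0_iff)
    have "int p dvd poly P (int i)" using insert.prems(3)[of i] by (simp add: cong_0_iff)
    then show ?case
      using Q by (subst P) (auto simp: cong_0_iff coeff_pCons split: nat.split)
  qed
qed

text \<open>Newton interpolation: for a new point, a multiple of the polynomial vanishing at the old
  points is added; its value at the new point is invertible modulo \<open>p\<close>.\<close>

lemma interpolation_cong_exists: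
  fixes v :: "nat \<Rightarrow> int"
  assumes "prime p" "A \<subseteq> {..<p}"
  shows "\<exists>P :: int poly. (\<forall>k\<ge>card A. coeff P k = 0) \<and>
           (\<forall>i\<in>A. [poly P (int i) = v i] (mod int p))"
proof -
  have "finite A" using assms(2) finite_subset by blast
  then show ?thesis using assms(2)
  proof (induction A rule: finite_induct)
    case empty
    show ?case by (intro exI[of _ 0]) simp
  next
    case (insert i A)
    then obtain P :: "int poly" where P: "\<And>k. k \<ge> card A \<Longrightarrow> coeff P k = 0"
      "\<And>i. i \<in> A \<Longrightarrow> [poly P (int i) = v i] (mod int p)" by auto
    define Z :: "int poly" where "Z = (\<Prod>a\<in>A. [:- int a, 1:])"
    have deg: "degree Z = card A"
      unfolding Z_def by (subst degree_prod_eq_sum_degree) auto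
    have Z0: "poly Z (int a) = 0" if "a \<in> A" for a
      using that insert.hyps by (auto simp: Z_def poly_prod)
    have "coprime (poly Z (int i)) (int p)"
      unfolding Z_def poly_prod
    proof (rule prod_coprime_left)
      fix a assume a: "a \<in> A"
      have "\<not> int p dvd int i - int a"
      proof
        assume "int p dvd int i - int a"
        then have "[i = a] (mod p)" by (simp add: cong_iff_dvd_diff flip: cong_int_iff)
        moreover have "i < p" "a < p" using insert.prems a by auto
        ultimately have "i = a" by (simp add: cong_def)
        then show False using a insert.hyps by simp
      qed
      then show "coprime (poly [:- int a, 1:] (int i)) (int p)"
        using \<open>prime p\<close> by (simp add: coprime_commute prime_imp_coprime)
    qed
    then obtain u where u: "[poly Z (int i) * u = 1] (mod int p)"
      using cong_solve_coprime_int by blast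
    define P' where "P' = P + smult (u * (v i - poly P (int i))) Z"
    have "coeff P' k = 0" if "k \<ge> card (insert i A)" for k
      using that insert.hyps P(1)[of k] by (simp add: P'_def coeff_eq_0 deg)
    moreover have "[poly P' (int a) = v a] (mod int p)" if "a \<in> A" for a
      using P(2)[OF that] Z0[OF that] by (simp add: P'_def)
    moreover have "[poly P' (int i) = v i] (mod int p)"
    proof -
      have "[poly P (int i) + (poly Z (int i) * u) * (v i - poly P (int i))
          = poly P (int i) + 1 * (v i - poly P (int i))] (mod int p)"
        by (intro cong_add cong_mult cong_refl u)
      then show ?thesis by (simp add: P'_def algebra_simps)
    qed
    ultimately show ?case by (intro exI[of _ P']) auto
  qed
qed

section \<open>Slots and shifted words\<close>

text \<open>On link \<open>k\<close>, \<open>Key i b\<close> and \<open>Mask i l\<close> belong to the hash with which \<open>k\<close> verifies link \<open>i\<close>,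
  whereas \<open>Tag j l\<close> is the tag of the payload of \<open>k\<close> to be checked by link \<open>j\<close>.\<close>
datatype slot = Pay nat nat | Key nat nat | Mask nat nat | Tag nat nat

definition slots :: "nat \<Rightarrow> nat \<Rightarrow> slot set" where
  "slots C s = case_prod Pay ` ({..<s} \<times> {..<s}) \<union> case_prod Key ` ({..<C} \<times> {..<s}) \<union>
     case_prod Mask ` ({..<C} \<times> {..<s}) \<union> case_prod Tag ` ({..<C} \<times> {..<s})"

lemma slots_iff [simp]:
  "Pay b l \<in> slots C s \<longleftrightarrow> b < s \<and> l < s"
  "Key j b \<in> slots C s \<longleftrightarrow> j < C \<and> b < s"
  "Mask j l \<in> slots C s \<longleftrightarrow> j < C \<and> l < s"
  "Tag j l \<in> slots C s \<longleftrightarrow> j < C \<and> l < s"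
  by (auto simp: slots_def)

lemma finite_slots: "finite (slots C s)"
  by (simp add: slots_def)

lemma card_slots_le: "card (slots C s) \<le> s * s + 3 * C * s"
proof -
  have img: "card (f ` ({..<a} \<times> {..<s})) \<le> a * s" for f :: "nat \<times> nat \<Rightarrow> slot" and a
    using card_image_le[of "{..<a} \<times> {..<s}" f] by simp
  have "card (slots C s) \<le> s * s + C * s + C * s + C * s"
    unfolding slots_def by (intro order_trans[OF card_Un_le] add_mono img)
  then show ?thesis by (simp add: algebra_simps)
qed

text \<open>The time slot of a symbol is given by an arbitrary injection \<open>pos\<close>, and \<open>g m (b, l, a)\<close> are the
  symbols of the message \<open>m\<close>, the top coefficients of the sharing polynomial at \<open>Pay b l\<close>.\<close>
locale hashed_sharing =
  fixes p C n s zr D K :: nat and pos :: "slot \<Rightarrow> nat" and g :: "nat \<Rightarrow> nat \<times> nat \<times> nat \<Rightarrow> nat"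
  assumes prime_p: "prime p" and C_le_p: "C \<le> p" and zr_less: "zr < D" and D_le: "D \<le> C"
    and K_pos: "K \<ge> 1"
    and inj_pos: "inj_on pos (slots C s)" and pos_less: "q \<in> slots C s \<Longrightarrow> pos q < n"
    and inj_g: "inj_on g {..<K}"
    and g_range: "m < K \<Longrightarrow> g m \<in> ({..<s} \<times> {..<s} \<times> {..<D - zr}) \<rightarrow>\<^sub>E {..<p}"
begin

abbreviation "\<V> \<equiv> words_on p {..<C} n"

lemma p_pos: "p > 0"
  using prime_p prime_gt_0_nat by blast

text \<open>All changes of codewords below have this form. The displacement \<open>d\<close> is
  indexed by link and slot, and symbols at times outside the range of \<open>pos\<close> receive
  displacement 0.\<close>

definition shift :: "word \<Rightarrow> (nat \<Rightarrow> slot \<Rightarrow> int) \<Rightarrow> word" where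
  "shift X d = (\<lambda>i t. if i < C \<and> t < n
     then nat ((int (X i t) +
       (if t \<in> pos ` slots C s then d i (inv_into (slots C s) pos t) else 0)) mod int p)
     else 0)"

lemma shift_in_words: "shift X d \<in> \<V>"
  using p_pos by (auto simp: words_on_def shift_def nat_less_iff)

lemma shift_cong:
  assumes "i < C" "q \<in> slots C s"
  shows "[int (shift X d i (pos q)) = int (X i (pos q)) + d i q] (mod int p)"
  using assms p_pos pos_less[OF assms(2)] by (simp add: shift_def inv_into_f_f[OF inj_pos] cong_def)

lemma words_eqI:
  assumes "X \<in> \<V>" "Y \<in> \<V>" "i < C \<Longrightarrow> t < n \<Longrightarrow> [int (X i t) = int (Y i t)] (mod int p)"
  shows "X i t = Y i t"
proof (cases "i < C \<and> t < n")
  case True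
  then have "X i t < p" "Y i t < p" "[X i t = Y i t] (mod p)"
    using assms by (auto simp: words_on_def cong_int_iff)
  then show ?thesis by (simp add: cong_def)
next
  case False
  then show ?thesis using assms(1,2) by (auto simp: words_on_def)
qed

lemma shift_same:
  assumes "X \<in> \<V>" "i < C \<Longrightarrow> t \<in> pos ` slots C s \<Longrightarrow> [d i (inv_into (slots C s) pos t) = 0] (mod int p)"
  shows "shift X d i t = X i t"
proof (rule words_eqI[OF shift_in_words assms(1)])
  assume it: "i < C" "t < n"
  show "[int (shift X d i t) = int (X i t)] (mod int p)"
  proof (cases "t \<in> pos ` slots C s")
    case True
    then have "[int (shift X d i t) = int (X i t) + d i (inv_into (slots C s) pos t)] (mod int p)"
      using it p_pos by (simp add: shift_def cong_def)
    moreover have "[int (X i t) + d i (inv_into (slots C s) pos t) = int (X i t) + 0] (mod int p)"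
      using assms(2) it True by (intro cong_add cong_refl) auto
    ultimately show ?thesis using cong_trans by fastforce
  qed (use it p_pos in \<open>simp add: shift_def cong_def\<close>)
qed

lemma shift_same_slot:
  assumes "X \<in> \<V>" "q \<in> slots C s" "[d i q = 0] (mod int p)"
  shows "shift X d i (pos q) = X i (pos q)"
  by (rule shift_same[OF assms(1)]) (use assms inv_into_f_f[OF inj_pos] in auto)

text \<open>Two displacements are allowed because in the applications the displacement depends on
  the word. Injectivity then reduces to recovering the displacement from the image.\<close>

lemma shift_inj:
  assumes "X \<in> \<V>" "Y \<in> \<V>" "shift X d = shift Y d'"
    "\<And>i q. i < C \<Longrightarrow> q \<in> slots C s \<Longrightarrow> d i q = d' i q"
  shows "X = Y"
proof (intro ext words_eqI[OF assms(1,2)])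
  fix i t assume it: "i < C" "t < n"
  let ?d = "if t \<in> pos ` slots C s then d i (inv_into (slots C s) pos t) else 0"
  have "?d = (if t \<in> pos ` slots C s then d' i (inv_into (slots C s) pos t) else 0)"
    using assms(4)[OF it(1), of "inv_into (slots C s) pos t"] inv_into_into[of t pos "slots C s"] by auto
  then have "nat ((int (X i t) + ?d) mod int p) = nat ((int (Y i t) + ?d) mod int p)"
    using fun_cong[OF fun_cong[OF assms(3), of i], of t] it by (simp add: shift_def)
  then have "[int (X i t) + ?d = int (Y i t) + ?d] (mod int p)"
    using p_pos unfolding cong_def by (subst (asm) eq_nat_nat_iff) simp_all
  then show "[int (X i t) = int (Y i t)] (mod int p)"
    by (simp add: cong_add_rcancel)
qed

section \<open>The codebook\<close>

text \<open>A masked inner product for each column \<open>l\<close> of the payload block. One key of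
  length \<open>s\<close> serves all \<open>s\<close> columns, while every column has its own
  mask.\<close>

definition verifies :: "word \<Rightarrow> nat \<Rightarrow> nat \<Rightarrow> bool" where
  "verifies Y j i \<longleftrightarrow> (\<forall>l<s. [int (Y i (pos (Tag j l))) =
     (\<Sum>b<s. int (Y j (pos (Key i b))) * int (Y i (pos (Pay b l)))) + int (Y j (pos (Mask i l)))]
     (mod int p))"

text \<open>Ramp secret sharing in the style of Shamir: the coefficients from \<open>zr\<close> to
  \<open>D - 1\<close> carry the message, and the lower ones are free and hide it. \<open>P\<close>
  matters only modulo \<open>p\<close>.\<close>

definition shares :: "nat \<Rightarrow> word \<Rightarrow> nat \<Rightarrow> nat \<Rightarrow> int poly \<Rightarrow> bool" where
  "shares m X b l P \<longleftrightarrow> (\<forall>k\<ge>D. coeff P k = 0) \<and>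
     (\<forall>a<D - zr. [coeff P (zr + a) = int (g m (b, l, a))] (mod int p)) \<and>
     (\<forall>i<C. [int (X i (pos (Pay b l))) = poly P (int i)] (mod int p))"

text \<open>Alice's randomness stays implicit: \<open>enc\<close> is uniform on this set, so
  distributions and probabilities are compared through injections into codebooks.\<close>

definition codebook :: "nat \<Rightarrow> word set" where
  "codebook m = {X \<in> \<V>. (\<forall>b<s. \<forall>l<s. \<exists>P. shares m X b l P) \<and> (\<forall>i<C. \<forall>j<C. verifies X j i)}"

lemma finite_codebook: "finite (codebook m)"
  by (simp add: codebook_def finite_words_on)

lemma codebook_shares: "X \<in> codebook m \<Longrightarrow> b < s \<Longrightarrow> l < s \<Longrightarrow> \<exists>P. shares m X b l P"
  by (simp add: codebook_def)

lemma message_poly_exists: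
  "\<exists>P :: int poly. (\<forall>k\<ge>D. coeff P k = 0) \<and> (\<forall>a<D - zr. coeff P (zr + a) = c a)"
  \<comment> \<open>Below \<open>zr\<close> the truncated subtraction yields the coefficient
    \<open>c 0\<close>; any value would do there.\<close>
  by (intro exI[of _ "\<Sum>k<D. monom (c (k - zr)) k"]) (auto simp: coeff_sum)

text \<open>With all keys, masks and tags 0 every test holds, so only the payloads have to be
  chosen.\<close>

lemma codebook_nonempty: "codebook m \<noteq> {}"
proof -
  have "\<forall>b l. \<exists>P. (\<forall>k\<ge>D. coeff P k = 0) \<and>
      (\<forall>a<D - zr. coeff P (zr + a) = int (g m (b, l, a)))"
    by (intro allI message_poly_exists)
  then obtain P where P: "\<forall>b l. (\<forall>k\<ge>D. coeff (P b l) k = 0) \<and>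
      (\<forall>a<D - zr. coeff (P b l) (zr + a) = int (g m (b, l, a)))"
    unfolding choice_iff ..
  define d where "d i q = (case q of Pay b l \<Rightarrow> poly (P b l) (int i) | _ \<Rightarrow> 0)" for i q
  define X where "X = shift (\<lambda>_ _. 0) d"
  have zero: "(\<lambda>_ _. 0) \<in> \<V>" using p_pos by (simp add: words_on_def)
  have "X i (pos q) = 0" if "q \<in> slots C s" "\<And>b l. q \<noteq> Pay b l" for i q
    unfolding X_def using that by (subst shift_same_slot[OF zero]) (auto simp: d_def split: slot.split)
  then have "verifies X j i" if "i < C" "j < C" for i j
    using that by (simp add: verifies_def)
  moreover have "shares m X b l (P b l)" if "b < s" "l < s" for b l
    using P that shift_cong[of _ "Pay b l" "\<lambda>_ _. 0" d] by (auto simp: shares_def X_def d_def)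
  ultimately have "X \<in> codebook m"
    unfolding codebook_def X_def using shift_in_words by blast
  then show ?thesis by blast
qed

section \<open>Perfect secrecy\<close>

text \<open>The core of secrecy: adding a sharing polynomial that vanishes on \<open>Z\<close>
  modulo \<open>p\<close> and has the difference of the messages as its top coefficients turns
  codewords for \<open>m\<close> into codewords for \<open>m'\<close> with the same view on
  \<open>Z\<close>.\<close>

lemma codebook_shift_exists:
  assumes Z: "Z \<subseteq> {..<C}" "card Z \<le> zr"
  shows "\<exists>f. inj_on f (codebook m) \<and> f ` codebook m \<subseteq> codebook m' \<and>
    (\<forall>X\<in>codebook m. restrict_links Z (f X) = restrict_links Z X)"
proof -
  have "\<exists>P. (\<forall>k\<ge>D. coeff P k = 0) \<and>
      (\<forall>a<D - zr. coeff P (zr + a) = int (g m' (b, l, a)) - int (g m (b, l, a))) \<and>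
      (\<forall>i\<in>Z. [poly P (int i) = 0] (mod int p))" for b l
  proof -
    obtain H where H: "\<forall>k\<ge>D. coeff H k = 0"
      "\<forall>a<D - zr. coeff H (zr + a) = int (g m' (b, l, a)) - int (g m (b, l, a))"
      using message_poly_exists[of "\<lambda>a. int (g m' (b, l, a)) - int (g m (b, l, a))"] by blast
    \<comment> \<open>\<open>Q\<close> cancels \<open>H\<close> on \<open>Z\<close>. Its
      coefficients from \<open>card Z \<le> zr\<close> on are 0, so the message coefficients of
      \<open>H\<close> survive.\<close>
    obtain Q where Q: "\<forall>k\<ge>card Z. coeff Q k = 0"
      "\<forall>i\<in>Z. [poly Q (int i) = - poly H (int i)] (mod int p)"
      using interpolation_cong_exists[OF prime_p, of Z] Z(1) C_le_p by (meson lessThan_subset_iff order_trans)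
    have "[poly (H + Q) (int i) = 0] (mod int p)" if "i \<in> Z" for i
      using cong_add[OF cong_refl[of "poly H (int i)"] Q(2)[rule_format, OF that]] by simp
    then show ?thesis
      using H Q(1) Z(2) zr_less by (intro exI[of _ "H + Q"]) auto
  qed
  then obtain P where P: "\<And>b l k. k \<ge> D \<Longrightarrow> coeff (P b l) k = 0"
    "\<And>b l a. a < D - zr \<Longrightarrow> coeff (P b l) (zr + a) = int (g m' (b, l, a)) - int (g m (b, l, a))"
    "\<And>b l i. i \<in> Z \<Longrightarrow> [poly (P b l) (int i) = 0] (mod int p)"
    by metis
  \<comment> \<open>Tags follow the payload linearly, while keys and masks stay fixed. The
    displacement depends on \<open>X\<close> only through the keys, which the image retains; this
    gives injectivity.\<close>
  define d where "d X i q = (case q of Pay b l \<Rightarrow> poly (P b l) (int i)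
      | Tag j l \<Rightarrow> (\<Sum>b<s. int (X j (pos (Key i b))) * poly (P b l) (int i)) | _ \<Rightarrow> 0)" for X :: word and i q
  define f where "f X = shift X (d X)" for X
  have keep: "f X i (pos q) = X i (pos q)"
    if "X \<in> \<V>" "q \<in> slots C s" "\<And>b l. q \<noteq> Pay b l" "\<And>j l. q \<noteq> Tag j l" for X i q
    unfolding f_def using that by (subst shift_same_slot) (auto simp: d_def split: slot.split)
  have "inj_on f (codebook m)"
  proof (rule inj_onI)
    fix X Y assume XY: "X \<in> codebook m" "Y \<in> codebook m" "f X = f Y"
    then have V: "X \<in> \<V>" "Y \<in> \<V>" by (auto simp: codebook_def)
    have "X j (pos (Key i b)) = Y j (pos (Key i b))" if "i < C" "b < s" for i j b
      using keep[OF V(1), of "Key i b" j] keep[OF V(2), of "Key i b" j] that XY(3) by simp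
    then show "X = Y"
      using shift_inj[OF V, of "d X" "d Y"] XY(3) by (auto simp: f_def d_def split: slot.split)
  qed
  moreover have "f X \<in> codebook m'" if X: "X \<in> codebook m" for X
  proof -
    have V: "X \<in> \<V>" using X by (simp add: codebook_def)
    have pay: "[int (f X i (pos (Pay b l))) = int (X i (pos (Pay b l))) + poly (P b l) (int i)] (mod int p)"
      if "i < C" "b < s" "l < s" for i b l
      using shift_cong[of i "Pay b l" X "d X"] that by (simp add: f_def d_def)
    have "\<exists>Q. shares m' (f X) b l Q" if bl: "b < s" "l < s" for b l
    proof -
      obtain Q where Q: "shares m X b l Q" using X bl unfolding codebook_def by blast
      have "[coeff (Q + P b l) (zr + a) = int (g m' (b, l, a))] (mod int p)" if "a < D - zr" for a
        using cong_add[OF _ cong_refl, of "coeff Q (zr + a)" "int (g m (b, l, a))" "int p"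
            "coeff (P b l) (zr + a)"] Q P(2)[OF that] that by (simp add: shares_def)
      moreover have "[int (f X i (pos (Pay b l))) = poly (Q + P b l) (int i)] (mod int p)"
        if "i < C" for i
        using cong_trans[OF pay[OF that bl] cong_add[OF _ cong_refl]] Q that by (simp add: shares_def)
      ultimately have "shares m' (f X) b l (Q + P b l)"
        using Q P(1) by (simp add: shares_def)
      then show ?thesis ..
    qed
    moreover have "verifies (f X) j i" if ij: "i < C" "j < C" for i j
      unfolding verifies_def
    proof (intro allI impI)
      fix l assume l: "l < s"
      let ?h = "\<Sum>b<s. int (X j (pos (Key i b))) * poly (P b l) (int i)"
      have 1: "[int (f X i (pos (Tag j l))) = int (X i (pos (Tag j l))) + ?h] (mod int p)"
        using shift_cong[of i "Tag j l" X "d X"] ij l by (simp add: f_def d_def)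
      have 2: "[int (X i (pos (Tag j l))) + ?h =
          ((\<Sum>b<s. int (X j (pos (Key i b))) * int (X i (pos (Pay b l)))) +
            int (X j (pos (Mask i l)))) + ?h] (mod int p)"
        using X ij l by (intro cong_add cong_refl) (auto simp: codebook_def verifies_def)
      have 3: "((\<Sum>b<s. int (X j (pos (Key i b))) * int (X i (pos (Pay b l)))) +
            int (X j (pos (Mask i l)))) + ?h =
        (\<Sum>b<s. int (f X j (pos (Key i b))) * (int (X i (pos (Pay b l))) + poly (P b l) (int i))) +
          int (f X j (pos (Mask i l)))"
        using keep[OF V] ij l by (simp add: algebra_simps sum.distrib)
      have 4: "[(\<Sum>b<s. int (f X j (pos (Key i b))) *
            (int (X i (pos (Pay b l))) + poly (P b l) (int i))) + int (f X j (pos (Mask i l))) =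
          (\<Sum>b<s. int (f X j (pos (Key i b))) * int (f X i (pos (Pay b l)))) +
            int (f X j (pos (Mask i l)))] (mod int p)"
        using pay[THEN cong_sym] ij l by (intro cong_add cong_refl cong_sum cong_mult) auto
      show "[int (f X i (pos (Tag j l))) =
          (\<Sum>b<s. int (f X j (pos (Key i b))) * int (f X i (pos (Pay b l)))) +
          int (f X j (pos (Mask i l)))] (mod int p)"
        using cong_trans[OF cong_trans[OF 1 2[unfolded 3]] 4] .
    qed
    ultimately show ?thesis
      using shift_in_words by (auto simp: codebook_def f_def)
  qed
  moreover have "restrict_links Z (f X) = restrict_links Z X" if X: "X \<in> codebook m" for X
  proof -
    have "[d X i q = 0] (mod int p)" if "i \<in> Z" for i q
      using P(3)[OF that] by (auto simp: d_def cong_0_iff intro!: dvd_sum split: slot.split)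
    then have "f X i t = X i t" if "i \<in> Z" for i t
      unfolding f_def using X that by (intro shift_same) (auto simp: codebook_def)
    then show ?thesis by (auto simp: restrict_links_def fun_eq_iff)
  qed
  ultimately show ?thesis by blast
qed

definition enc :: "nat \<Rightarrow> word pmf" where
  "enc m = pmf_of_set (codebook m)"

text \<open>Injections in both directions between finite codebooks make \<open>f\<close> a
  bijection, which carries one uniform distribution to the other and preserves the view on
  \<open>Z\<close>.\<close>

lemma restrict_enc_eq:
  assumes Z: "Z \<subseteq> {..<C}" "card Z \<le> zr"
  shows "map_pmf (restrict_links Z) (enc m) = map_pmf (restrict_links Z) (enc m')"
proof -
  obtain f where f: "inj_on f (codebook m)" "f ` codebook m \<subseteq> codebook m'"
    "\<And>X. X \<in> codebook m \<Longrightarrow> restrict_links Z (f X) = restrict_links Z X"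
    using codebook_shift_exists[OF Z, of m m'] by blast
  obtain f' where f': "inj_on f' (codebook m')" "f' ` codebook m' \<subseteq> codebook m"
    using codebook_shift_exists[OF Z, of m' m] by blast
  have "card (codebook m') \<le> card (f ` codebook m)"
    using card_inj_on_le[OF f' finite_codebook] f(1) by (simp add: card_image)
  then have "f ` codebook m = codebook m'"
    using f(2) finite_codebook by (intro card_seteq) auto
  then have "enc m' = map_pmf f (enc m)"
    unfolding enc_def by (simp add: map_pmf_of_set_inj f(1) codebook_nonempty finite_codebook)
  then show ?thesis
    using f(3) by (auto simp: pmf.map_comp enc_def codebook_nonempty finite_codebook intro!: map_pmf_cong)
qed

lemma secret_enc: "secret C zr K enc"
  unfolding secret_def
proof (intro allI impI)
  fix Z assume Z: "Z \<subseteq> {..<C} \<and> card Z \<le> zr"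
  have "msg_pmf K \<bind> (\<lambda>m. map_pmf (\<lambda>X. (m, restrict_links Z X)) (enc m)) =
    msg_pmf K \<bind> (\<lambda>m. map_pmf (Pair m) (map_pmf (restrict_links Z) (enc m)))"
    by (simp add: pmf.map_comp o_def)
  also have "\<dots> = msg_pmf K \<bind> (\<lambda>m. map_pmf (Pair m) (map_pmf (restrict_links Z) (enc 0)))"
    using restrict_enc_eq Z by metis
  also have "\<dots> = pair_pmf (msg_pmf K) (map_pmf (restrict_links Z) (enc 0))"
    by (simp add: pair_pmf_def map_pmf_def)
  finally show "mutual_info (msg_pmf K \<bind> (\<lambda>m. map_pmf (\<lambda>X. (m, restrict_links Z X)) (enc m))) = 0"
    by (simp add: mutual_info_pair_pmf)
qed

lemma set_enc: "set_pmf (enc m) = codebook m"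
  by (simp add: enc_def codebook_nonempty finite_codebook)

lemma valid_enc: "valid_code p C n K enc"
  using K_pos by (auto simp: valid_code_def set_enc codebook_def words_on_def)

section \<open>Forged payloads\<close>

lemma received_cong:
  assumes "i < C" "q \<in> slots C s"
  shows "[int (received_add p C n E X i (pos q)) = int (X i (pos q)) + int (E X i (pos q))] (mod int p)"
  using assms pos_less[OF assms(2)] by (simp add: received_add_def zmod_int cong_def)

lemma received_in_words: "received_add p C n E X \<in> \<V>"
  using p_pos by (auto simp: received_add_def words_on_def)

definition forged :: "(word \<Rightarrow> word) \<Rightarrow> nat \<Rightarrow> nat \<Rightarrow> nat \<Rightarrow> word set" where
  "forged E m j i = {X \<in> codebook m. verifies (received_add p C n E X) j i \<and>
     (\<exists>b<s. \<exists>l<s. received_add p C n E X i (pos (Pay b l)) \<noteq> X i (pos (Pay b l)))}"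

text \<open>Link \<open>j\<close> is unread, so shifting one symbol of its key for \<open>i\<close> and compensating in the mask
  changes neither the view of the adversary nor membership in the codebook. Among the \<open>p\<close> shifts
  of a word at most one lets a given forgery through.\<close>
lemma card_forged_le:
  assumes adv: "admissible_adv C zrw zro zwo Zrw Zro Zwo E"
    and j: "j < C" "j \<notin> Zrw \<union> Zro" and i: "i < C"
  shows "card (forged E m j i) * p \<le> card (codebook m)"
proof -
  \<comment> \<open>The position \<open>(b0 X, l0 X)\<close> of a modified payload symbol is chosen
    from \<open>E X\<close> alone. It is therefore the same for all shifts of a word.\<close>
  define hitp where "hitp X = (\<lambda>(b, l). b < s \<and> l < s \<and> \<not> int p dvd int (E X i (pos (Pay b l))))" for X
  define w where "w X = (SOME bl. hitp X bl)" for X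
  define b0 where "b0 X = fst (w X)" for X
  define l0 where "l0 X = snd (w X)" for X
  have w: "b0 X < s" "l0 X < s" "\<not> int p dvd int (E X i (pos (Pay (b0 X) (l0 X))))"
    if X: "X \<in> forged E m j i" for X
  proof -
    obtain b l where bl: "b < s" "l < s"
      and ne: "received_add p C n E X i (pos (Pay b l)) \<noteq> X i (pos (Pay b l))"
      using X unfolding forged_def by blast
    have "X \<in> \<V>" using X by (auto simp: forged_def codebook_def)
    have "\<not> int p dvd int (E X i (pos (Pay b l)))"
    proof
      assume "int p dvd int (E X i (pos (Pay b l)))"
      then have "[int (X i (pos (Pay b l))) + int (E X i (pos (Pay b l))) =
          int (X i (pos (Pay b l))) + 0] (mod int p)"
        by (intro cong_add cong_refl) (simp add: cong_0_iff)
      then have "[int (received_add p C n E X i (pos (Pay b l))) = int (X i (pos (Pay b l)))] (mod int p)"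
        using cong_trans[OF received_cong[OF i, of "Pay b l" E X]] bl by simp
      then show False
        using ne words_eqI[OF received_in_words \<open>X \<in> \<V>\<close>] by blast
    qed
    then have "hitp X (b, l)" using bl by (simp add: hitp_def)
    then have "hitp X (w X)" unfolding w_def by (rule someI)
    then show "b0 X < s" "l0 X < s" "\<not> int p dvd int (E X i (pos (Pay (b0 X) (l0 X))))"
      by (auto simp: hitp_def b0_def l0_def case_prod_unfold)
  qed
  \<comment> \<open>The key symbol that multiplies the modified row is raised by \<open>u\<close>,
    and each mask drops by \<open>u\<close> times the genuine symbol of that row. Tests of genuine
    payloads are unaffected.\<close>
  define d where "d X u k q = (if k = j then (case q of
      Key i' b \<Rightarrow> if i' = i \<and> b = b0 X then u else 0
    | Mask i' l \<Rightarrow> if i' = i then - (u * int (X i (pos (Pay (b0 X) l)))) else 0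
    | _ \<Rightarrow> 0) else 0)" for X :: word and u :: int and k :: nat and q
  define f where "f = (\<lambda>(X, u). shift X (d X (int u)))"
  have in_V: "X \<in> \<V>" if "X \<in> forged E m j i" for X
    using that by (simp add: forged_def codebook_def)
  have other_link: "f (X, u) k = X k" if "X \<in> \<V>" "k \<noteq> j" for X u k
    unfolding f_def using that by (intro ext) (simp add: shift_same d_def)
  have keep: "f (X, u) k (pos q) = X k (pos q)"
    if "X \<in> \<V>" "q \<in> slots C s" "\<And>i b. q \<noteq> Key i b" "\<And>i l. q \<noteq> Mask i l" for X u k q
    unfolding f_def using that by (auto simp: d_def intro!: shift_same_slot split: slot.split)
  have key: "[int (f (X, u) k (pos (Key a b))) = int (X k (pos (Key a b))) +
      (if k = j \<and> a = i \<and> b = b0 X then int u else 0)] (mod int p)"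
    if "k < C" "a < C" "b < s" for X u k a b
    using shift_cong[of k "Key a b" X "d X (int u)"] that by (auto simp: f_def d_def split: if_splits)
  have mask: "[int (f (X, u) k (pos (Mask a l))) = int (X k (pos (Mask a l))) +
      (if k = j \<and> a = i then - (int u * int (X i (pos (Pay (b0 X) l)))) else 0)] (mod int p)"
    if "k < C" "a < C" "l < s" for X u k a l
    using shift_cong[of k "Mask a l" X "d X (int u)"] that by (auto simp: f_def d_def split: if_splits)
  \<comment> \<open>Only the unread link \<open>j\<close> differs, so all noise is the same,
    including any noise on \<open>j\<close> itself.\<close>
  have E_eq: "E (f (X, u)) = E X" if "X \<in> \<V>" for X u
  proof (intro ext)
    fix k t
    have "\<forall>a\<in>Zrw \<union> Zro. \<forall>s\<le>t. f (X, u) a s = X a s"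
      using other_link[OF that] j(2) by metis
    then show "E (f (X, u)) k t = E X k t"
      using adv unfolding admissible_adv_def by blast
  qed
  have f_codebook: "f (X, u) \<in> codebook m" if X: "X \<in> forged E m j i" for X u
  proof -
    note V = in_V[OF X]
    have "\<exists>P. shares m (f (X, u)) b l P" if bl: "b < s" "l < s" for b l
    proof -
      have "X \<in> codebook m" using X by (simp add: forged_def)
      then obtain P where "shares m X b l P" using codebook_shares bl by blast
      then have "shares m (f (X, u)) b l P"
        using keep[OF V, of "Pay b l"] that by (simp add: shares_def)
      then show ?thesis ..
    qed
    moreover have "verifies (f (X, u)) k a" if ak: "a < C" "k < C" for a k
      unfolding verifies_def
    proof (intro allI impI)
      fix l assume l: "l < s"
      let ?x = "\<lambda>b. int (X a (pos (Pay b l)))"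
      let ?\<delta> = "\<lambda>b. if k = j \<and> a = i \<and> b = b0 X then int u else 0"
      let ?\<mu> = "if k = j \<and> a = i then - (int u * int (X i (pos (Pay (b0 X) l)))) else 0"
      have "[(\<Sum>b<s. int (f (X, u) k (pos (Key a b))) * ?x b) + int (f (X, u) k (pos (Mask a l))) =
          (\<Sum>b<s. (int (X k (pos (Key a b))) + ?\<delta> b) * ?x b) + (int (X k (pos (Mask a l))) + ?\<mu>)] (mod int p)"
        using key mask ak l by (intro cong_add cong_sum cong_mult cong_refl) auto
      moreover have "(\<Sum>b<s. ?\<delta> b * ?x b) + ?\<mu> = 0"
      proof (cases "k = j \<and> a = i")
        case True
        have "(\<Sum>b<s. ?\<delta> b * ?x b) = (\<Sum>b<s. if b = b0 X then int u * ?x b else 0)"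
          using True by (intro sum.cong) auto
        then show ?thesis using True w(1)[OF X] by simp
      qed auto
      then have "(\<Sum>b<s. (int (X k (pos (Key a b))) + ?\<delta> b) * ?x b) + (int (X k (pos (Mask a l))) + ?\<mu>) =
          (\<Sum>b<s. int (X k (pos (Key a b))) * ?x b) + int (X k (pos (Mask a l)))"
        by (simp add: distrib_right sum.distrib)
      moreover have "[int (X a (pos (Tag k l))) =
          (\<Sum>b<s. int (X k (pos (Key a b))) * ?x b) + int (X k (pos (Mask a l)))] (mod int p)"
        using X ak l by (simp add: forged_def codebook_def verifies_def)
      ultimately have "[int (X a (pos (Tag k l))) =
          (\<Sum>b<s. int (f (X, u) k (pos (Key a b))) * ?x b) + int (f (X, u) k (pos (Mask a l)))] (mod int p)"
        by (simp add: cong_def)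
      then show "[int (f (X, u) a (pos (Tag k l))) =
          (\<Sum>b<s. int (f (X, u) k (pos (Key a b))) * int (f (X, u) a (pos (Pay b l)))) +
          int (f (X, u) k (pos (Mask a l)))] (mod int p)"
        using keep[OF V] ak l by simp
    qed
    ultimately show ?thesis
      using shift_in_words by (auto simp: codebook_def f_def)
  qed
  \<comment> \<open>The residual of the test in column \<open>l0 V\<close> after jamming, computed
    from \<open>V\<close> alone. For a shift by \<open>u\<close> of a forged word it equals
    \<open>u\<close> times the nonzero payload error, as the mask compensates only for the genuine
    symbol.\<close>
  define c where "c V = (\<Sum>b<s. (int (V j (pos (Key i b))) + int (E V j (pos (Key i b)))) *
      (int (V i (pos (Pay b (l0 V)))) + int (E V i (pos (Pay b (l0 V)))))) +
      (int (V j (pos (Mask i (l0 V)))) + int (E V j (pos (Mask i (l0 V))))) -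
      (int (V i (pos (Tag j (l0 V)))) + int (E V i (pos (Tag j (l0 V)))))" for V
  have w_eq: "b0 (f (X, u)) = b0 X" "l0 (f (X, u)) = l0 X" if "X \<in> \<V>" for X u
    using E_eq[OF that] by (simp_all add: b0_def l0_def w_def hitp_def)
  have eq: "[int u * int (E V i (pos (Pay (b0 V) (l0 V)))) = c V] (mod int p)"
    if X: "X \<in> forged E m j i" and V_def: "V = f (X, u)" for X u V
  proof -
    note V = in_V[OF X]
    define l where "l = l0 X"
    have l: "l < s" using w[OF X] by (simp add: l_def)
    have b0: "b0 X < s" using w[OF X] by simp
    let ?x = "\<lambda>b. int (X i (pos (Pay b l)))" and ?e = "\<lambda>b. int (E X i (pos (Pay b l)))"
    let ?k = "\<lambda>b. int (X j (pos (Key i b)))" and ?ek = "\<lambda>b. int (E X j (pos (Key i b)))"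
    let ?r = "int (X j (pos (Mask i l)))" and ?er = "int (E X j (pos (Mask i l)))"
    let ?t = "int (X i (pos (Tag j l)))" and ?et = "int (E X i (pos (Tag j l)))"
    have c: "c V = (\<Sum>b<s. (int (V j (pos (Key i b))) + ?ek b) * (?x b + ?e b)) +
        (int (V j (pos (Mask i l))) + ?er) - (?t + ?et)"
      using keep[OF V] j i l by (simp add: c_def V_def w_eq[OF V] E_eq[OF V] l_def[symmetric])
    have 1: "[c V = (\<Sum>b<s. ((?k b + (if b = b0 X then int u else 0)) + ?ek b) * (?x b + ?e b)) +
        ((?r + - (int u * ?x (b0 X))) + ?er) - (?t + ?et)] (mod int p)"
      unfolding c unfolding V_def using key[of j i _ X u] mask[of j i l X u] j i l
      by (intro cong_add cong_diff cong_sum cong_mult cong_refl) auto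
    have "(\<Sum>b<s. (if b = b0 X then int u else 0) * (?x b + ?e b)) = int u * (?x (b0 X) + ?e (b0 X))"
      using b0 by (simp add: if_distrib[where f = "\<lambda>z. z * _"] cong: if_cong)
    then have 2: "(\<Sum>b<s. ((?k b + (if b = b0 X then int u else 0)) + ?ek b) * (?x b + ?e b)) =
        (\<Sum>b<s. (?k b + ?ek b) * (?x b + ?e b)) + int u * (?x (b0 X) + ?e (b0 X))"
      by (simp add: sum.distrib algebra_simps)
    let ?Y = "received_add p C n E X"
    have 3: "[int (?Y i (pos (Tag j l))) =
        (\<Sum>b<s. int (?Y j (pos (Key i b))) * int (?Y i (pos (Pay b l)))) + int (?Y j (pos (Mask i l)))] (mod int p)"
      using X l by (simp add: forged_def verifies_def)
    have 4: "[(\<Sum>b<s. int (?Y j (pos (Key i b))) * int (?Y i (pos (Pay b l)))) + int (?Y j (pos (Mask i l))) =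
        (\<Sum>b<s. (?k b + ?ek b) * (?x b + ?e b)) + (?r + ?er)] (mod int p)"
      using i j l by (intro cong_add cong_sum cong_mult received_cong) auto
    have 5: "[?t + ?et = int (?Y i (pos (Tag j l)))] (mod int p)"
      using i j l by (intro cong_sym[OF received_cong]) auto
    have 6: "[?t + ?et = (\<Sum>b<s. (?k b + ?ek b) * (?x b + ?e b)) + (?r + ?er)] (mod int p)"
      using cong_trans[OF cong_trans[OF 5 3] 4] .
    have 7: "[(\<Sum>b<s. (?k b + ?ek b) * (?x b + ?e b)) + (?r + ?er) - (?t + ?et) + int u * ?e (b0 X)
        = 0 + int u * ?e (b0 X)] (mod int p)"
      using 6[THEN cong_sym] by (intro cong_add cong_refl) (simp only: cong_diff_iff_cong_0)
    have 8: "(\<Sum>b<s. ((?k b + (if b = b0 X then int u else 0)) + ?ek b) * (?x b + ?e b)) +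
        ((?r + - (int u * ?x (b0 X))) + ?er) - (?t + ?et) =
        (\<Sum>b<s. (?k b + ?ek b) * (?x b + ?e b)) + (?r + ?er) - (?t + ?et) + int u * ?e (b0 X)"
      unfolding 2 by (simp add: algebra_simps)
    have "[c V = int u * ?e (b0 X)] (mod int p)"
      using cong_trans[OF 1[unfolded 8] 7] by simp
    then show ?thesis
      by (simp add: V_def w_eq[OF V] E_eq[OF V] l_def cong_sym_eq)
  qed
  \<comment> \<open>The image fixes \<open>u\<close> modulo \<open>p\<close> by \<open>eq\<close>,
    since the payload error is a unit. It also retains the payload and the position, hence the whole
    displacement.\<close>
  have "inj_on f (forged E m j i \<times> {..<p})"
  proof (rule inj_onI, clarify)
    fix X u X' u'
    assume X: "X \<in> forged E m j i" "X' \<in> forged E m j i" and u: "u < p" "u' < p"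
      and ff: "f (X, u) = f (X', u')"
    note V = in_V[OF X(1)] in_V[OF X(2)]
    define Y where "Y = f (X, u)"
    let ?e = "int (E Y i (pos (Pay (b0 Y) (l0 Y))))"
    have "[int u * ?e = int u' * ?e] (mod int p)"
      using cong_trans[OF eq[OF X(1) Y_def] cong_sym[OF eq[OF X(2), of Y u']]] ff Y_def by simp
    moreover have "\<not> int p dvd ?e"
      using w(3)[OF X(1)] by (simp add: Y_def w_eq[OF V(1)] E_eq[OF V(1)])
    then have "coprime ?e (int p)"
      using prime_p by (simp add: coprime_commute prime_imp_coprime)
    ultimately have "[int u = int u'] (mod int p)"
      by (simp add: cong_mult_rcancel)
    then have "u = u'" using u by (simp add: cong_int_iff cong_def)
    moreover have "b0 X = b0 X'"
      using w_eq[OF V(1), of u] w_eq[OF V(2), of u'] ff by simp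
    moreover have "X i (pos (Pay b l)) = X' i (pos (Pay b l))" if "b < s" "l < s" for b l
      using keep[OF V(1), of "Pay b l" u i] keep[OF V(2), of "Pay b l" u' i] ff that by simp
    ultimately have "d X (int u) k q = d X' (int u') k q" if "q \<in> slots C s" for k q
      using that w(1)[OF X(1)] by (auto simp: d_def split: slot.split)
    then have "X = X'"
      using shift_inj[OF V, of "d X (int u)" "d X' (int u')"] ff by (simp add: f_def)
    then show "X = X' \<and> u = u'" using \<open>u = u'\<close> by simp
  qed
  moreover have "f ` (forged E m j i \<times> {..<p}) \<subseteq> codebook m"
    using f_codebook by auto
  ultimately have "card (forged E m j i \<times> {..<p}) \<le> card (codebook m)"
    using card_inj_on_le finite_codebook by blast
  then show ?thesis by (simp add: card_cartesian_product)
qed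

section \<open>Decoding and error probability\<close>

definition accepted :: "word \<Rightarrow> nat set" where
  "accepted Y = {i. i < C \<and> zr < card {j. j < C \<and> verifies Y j i}}"

definition agrees :: "nat set \<Rightarrow> word \<Rightarrow> word \<Rightarrow> bool" where
  "agrees A X Y \<longleftrightarrow> (\<forall>i\<in>A. \<forall>b<s. \<forall>l<s. X i (pos (Pay b l)) = Y i (pos (Pay b l)))"

definition decoder :: "word \<Rightarrow> nat" where
  "decoder Y = (SOME m. m < K \<and> (\<exists>X\<in>codebook m. agrees (accepted Y) X Y))"

text \<open>The difference of two sharing polynomials vanishes modulo \<open>p\<close> at
  \<open>card A \<ge> D\<close> points, so all its coefficients do. Message symbols lie below
  \<open>p\<close> and are thus equal.\<close>

lemma codebook_agree_imp_eq:
  assumes m: "m < K" "m' < K" and X: "X \<in> codebook m" "X' \<in> codebook m'"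
    and A: "A \<subseteq> {..<C}" "card A \<ge> D" and agree: "agrees A X X'"
  shows "m = m'"
proof -
  have "g m (b, l, a) = g m' (b, l, a)" if bl: "b < s" "l < s" and a: "a < D - zr" for b l a
  proof -
    obtain P where P: "shares m X b l P" using codebook_shares X(1) bl by blast
    obtain P' where P': "shares m' X' b l P'" using codebook_shares X(2) bl by blast
    have "[coeff (P - P') (zr + a) = 0] (mod int p)"
    proof (rule vanishing_poly_cong_0[OF prime_p])
      show "A \<subseteq> {..<p}" using A C_le_p by auto
      show "coeff (P - P') k = 0" if "k \<ge> card A" for k
        using P P' A(2) that by (simp add: shares_def)
      fix i assume i: "i \<in> A"
      then have "i < C" using A by auto
      then have "[int (X i (pos (Pay b l))) = poly P (int i)] (mod int p)"
        "[int (X i (pos (Pay b l))) = poly P' (int i)] (mod int p)"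
        using P P' agree i bl by (auto simp: shares_def agrees_def)
      then show "[poly (P - P') (int i) = 0] (mod int p)"
        by (simp add: cong_def cong_diff_iff_cong_0[unfolded cong_def, simplified])
    qed
    then have "[coeff P (zr + a) = coeff P' (zr + a)] (mod int p)"
      by (simp add: cong_diff_iff_cong_0)
    moreover have "[coeff P (zr + a) = int (g m (b, l, a))] (mod int p)"
      "[coeff P' (zr + a) = int (g m' (b, l, a))] (mod int p)"
      using P P' a by (auto simp: shares_def)
    ultimately have "[int (g m (b, l, a)) = int (g m' (b, l, a))] (mod int p)"
      by (simp add: cong_def)
    moreover have "g m (b, l, a) < p" "g m' (b, l, a) < p"
      using PiE_mem[OF g_range[OF m(1)], of "(b, l, a)"] PiE_mem[OF g_range[OF m(2)], of "(b, l, a)"] bl a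
      by auto
    ultimately show ?thesis by (simp add: cong_int_iff cong_def)
  qed
  then have "g m = g m'"
    by (intro PiE_ext[OF g_range[OF m(1)] g_range[OF m(2)]]) auto
  then show ?thesis using inj_g m by (auto dest: inj_onD)
qed

lemma decoder_correct:
  assumes adv: "admissible_adv C zrw zro zwo Zrw Zro Zwo E"
    and zr: "zr = zrw + zro" and D: "D = C - (zrw + zwo)"
    and m: "m < K" and X: "X \<in> codebook m"
    and good: "\<And>i j. i < C \<Longrightarrow> j < C \<Longrightarrow> j \<notin> Zrw \<union> Zro \<Longrightarrow> X \<notin> forged E m j i"
  shows "decoder (received_add p C n E X) = m"
proof -
  let ?Y = "received_add p C n E X"
  have Zsub: "Zrw \<union> Zro \<union> Zwo \<subseteq> {..<C}" and card_Z: "card Zrw \<le> zrw" "card Zro \<le> zro" "card Zwo \<le> zwo"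
    and E0: "\<And>i t. i \<notin> Zrw \<union> Zwo \<Longrightarrow> E X i t = 0"
    using adv unfolding admissible_adv_def by blast+
  have fin: "finite Zrw" "finite Zro" "finite Zwo"
    using Zsub finite_subset[OF _ finite_lessThan[of C]] by auto
  have V: "X \<in> \<V>" using X by (simp add: codebook_def)
  define U where "U = {..<C} - (Zrw \<union> Zwo)"
  have card_U: "card U \<ge> D"
  proof -
    have "card (Zrw \<union> Zwo) \<le> zrw + zwo"
      using card_Un_le[of Zrw Zwo] card_Z by simp
    moreover have "card U = C - card (Zrw \<union> Zwo)"
      unfolding U_def using Zsub fin by (subst card_Diff_subset) auto
    ultimately show ?thesis by (simp add: D)
  qed
  have U_eq: "?Y i = X i" if "i \<in> U" for i
    using that E0[of i] V by (auto simp: U_def received_add_def words_on_def fun_eq_iff)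
  have "U \<subseteq> accepted ?Y"
  proof
    fix i assume i: "i \<in> U"
    then have "i < C" by (simp add: U_def)
    \<comment> \<open>Unjammed links arrive intact, so they verify one another; there are at least
      \<open>D > zr\<close> of them.\<close>
    have "verifies ?Y j i" if "j \<in> U" for j
    proof -
      have "verifies X j i" using X \<open>i < C\<close> that by (simp add: codebook_def U_def)
      then show ?thesis by (simp add: verifies_def U_eq[OF i] U_eq[OF that])
    qed
    then have "U \<subseteq> {j. j < C \<and> verifies ?Y j i}" by (auto simp: U_def)
    then have "card U \<le> card {j. j < C \<and> verifies ?Y j i}"
      by (intro card_mono) auto
    then show "i \<in> accepted ?Y"
      using \<open>i < C\<close> card_U zr_less by (simp add: accepted_def)
  qed
  moreover have acc: "accepted ?Y \<subseteq> {..<C}" by (auto simp: accepted_def)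
  ultimately have card_acc: "card (accepted ?Y) \<ge> D"
    using card_U card_mono[OF finite_subset[OF acc], of U] by simp
  have agree: "agrees (accepted ?Y) X ?Y"
    unfolding agrees_def
  proof (intro ballI allI impI)
    fix i b l assume i: "i \<in> accepted ?Y" and bl: "b < s" "l < s"
    \<comment> \<open>An accepted link has more than \<open>zr\<close> verifiers, so at least one of
      them is unread, and \<open>good\<close> rules out a forgery against it.\<close>
    have "\<not> {j. j < C \<and> verifies ?Y j i} \<subseteq> Zrw \<union> Zro"
    proof
      assume "{j. j < C \<and> verifies ?Y j i} \<subseteq> Zrw \<union> Zro"
      then have "card {j. j < C \<and> verifies ?Y j i} \<le> card (Zrw \<union> Zro)"
        using fin by (intro card_mono) auto
      also have "\<dots> \<le> zr" using card_Un_le[of Zrw Zro] card_Z by (simp add: zr)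
      finally show False using i by (simp add: accepted_def)
    qed
    then obtain j where j: "j < C" "verifies ?Y j i" "j \<notin> Zrw \<union> Zro" by blast
    have "i < C" using i by (simp add: accepted_def)
    then have "X \<notin> forged E m j i" using good j by blast
    then show "X i (pos (Pay b l)) = ?Y i (pos (Pay b l))"
      using X j(2) bl unfolding forged_def by (auto dest: sym)
  qed
  show ?thesis
    unfolding decoder_def
  proof (rule some_equality)
    show "m < K \<and> (\<exists>X\<in>codebook m. agrees (accepted ?Y) X ?Y)"
      using m X agree by blast
    fix m' assume "m' < K \<and> (\<exists>X\<in>codebook m'. agrees (accepted ?Y) X ?Y)"
    then obtain X' where X': "m' < K" "X' \<in> codebook m'" "agrees (accepted ?Y) X' ?Y" by blast
    have "agrees (accepted ?Y) X' X"
      using X'(3) agree by (simp add: agrees_def)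
    then show "m' = m"
      using codebook_agree_imp_eq[OF X'(1) m X'(2) X acc card_acc] by blast
  qed
qed

text \<open>Union bound: a decoding error requires a forgery for some unread \<open>j\<close> and
  some \<open>i\<close>, and each such pair accounts for at most a fraction \<open>1/p\<close> of
  the codebook.\<close>

lemma error_prob_le:
  assumes adv: "admissible_adv C zrw zro zwo Zrw Zro Zwo E"
    and zr: "zr = zrw + zro" and D: "D = C - (zrw + zwo)"
  shows "error_prob_add p C n K enc decoder E \<le> real (C * C) / real p"
proof -
  define wrong where "wrong = {(m, X). decoder (received_add p C n E X) \<noteq> m}"
  have msg: "set_pmf (msg_pmf K) = {0..<K}" using K_pos by (simp add: msg_pmf_def)
  have bound: "measure_pmf.prob (map_pmf (Pair m) (enc m)) wrong \<le> real (C * C) / real p" if m: "m < K" for m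
  proof -
    define I where "I = ({..<C} - (Zrw \<union> Zro)) \<times> {..<C}"
    have fin_I: "finite I" by (simp add: I_def)
    have card_I: "card I \<le> C * C"
      using card_mono[of "{..<C} \<times> {..<C}" I] by (auto simp: I_def)
    have "codebook m \<inter> Pair m -` wrong \<subseteq> (\<Union>(j, i)\<in>I. forged E m j i)"
      using decoder_correct[OF adv zr D m] by (fastforce simp: wrong_def I_def)
    then have "card (codebook m \<inter> Pair m -` wrong) \<le> card (\<Union>(j, i)\<in>I. forged E m j i)"
      using fin_I finite_codebook by (intro card_mono finite_UN_I) (auto simp: forged_def)
    also have "\<dots> \<le> (\<Sum>(j, i)\<in>I. card (forged E m j i))"
      using card_UN_le[OF fin_I, of "\<lambda>(j, i). forged E m j i"] by (simp add: case_prod_unfold)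
    finally have "card (codebook m \<inter> Pair m -` wrong) * p \<le> (\<Sum>(j, i)\<in>I. card (forged E m j i)) * p"
      by (rule mult_right_mono) simp
    also have "\<dots> = (\<Sum>(j, i)\<in>I. card (forged E m j i) * p)"
      by (simp add: sum_distrib_right case_prod_unfold)
    also have "\<dots> \<le> (\<Sum>_\<in>I. card (codebook m))"
      using card_forged_le[OF adv] by (intro sum_mono) (auto simp: I_def)
    also have "\<dots> \<le> C * C * card (codebook m)"
      using card_I by simp
    finally have "real (card (codebook m \<inter> Pair m -` wrong)) * real p \<le> real (C * C) * real (card (codebook m))"
      by (metis of_nat_le_iff of_nat_mult)
    moreover have "card (codebook m) > 0"
      using codebook_nonempty finite_codebook by (simp add: card_gt_0_iff)
    ultimately have "real (card (codebook m \<inter> Pair m -` wrong)) / real (card (codebook m)) \<le> real (C * C) / real p"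
      using p_pos by (simp add: field_simps)
    then show ?thesis
      by (simp add: enc_def measure_pmf_of_set codebook_nonempty finite_codebook)
  qed
  have "error_prob_add p C n K enc decoder E =
      measure_pmf.prob (msg_pmf K \<bind> (\<lambda>m. map_pmf (Pair m) (enc m))) wrong"
    by (simp add: error_prob_add_def wrong_def)
  also have "\<dots> \<le> real (C * C) / real p"
  proof -
    have "emeasure (bind_pmf (msg_pmf K) (\<lambda>m. map_pmf (Pair m) (enc m))) wrong =
        (\<integral>\<^sup>+m. emeasure (map_pmf (Pair m) (enc m)) wrong \<partial>msg_pmf K)"
      by (rule emeasure_bind_pmf)
    also have "\<dots> \<le> (\<integral>\<^sup>+m. ennreal (real (C * C) / real p) \<partial>msg_pmf K)"
    proof (rule nn_integral_mono_AE, subst AE_measure_pmf_iff, rule ballI)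
      fix m assume "m \<in> set_pmf (msg_pmf K)"
      then have "m < K" by (simp add: msg)
      then show "emeasure (map_pmf (Pair m) (enc m)) wrong \<le> ennreal (real (C * C) / real p)"
        unfolding measure_pmf.emeasure_eq_measure by (intro ennreal_leI bound)
    qed
    also have "\<dots> = ennreal (real (C * C) / real p)" by simp
    finally show ?thesis
      unfolding measure_pmf.emeasure_eq_measure by (subst (asm) ennreal_le_iff) auto
  qed
  finally show ?thesis .
qed

end

section \<open>Parameters and achievable rates\<close>

text \<open>The block side \<open>s\<close> is \<open>sqrt n\<close> up to a constant, so the
  overhead linear in \<open>s\<close> costs no rate in the limit.\<close>

lemma square_block_fits:
  fixes C d :: nat and R :: real
  assumes "R < real d"
  shows "\<exists>N. \<forall>n\<ge>N. \<exists>s. s * s + 3 * C * s \<le> n \<and> real n * R \<le> real (s * s * d)"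
proof -
  define c where "c = real (2 * C + 1)"
  have "filterlim (\<lambda>n. sqrt (real n)) at_top sequentially"
    by real_asymp
  then have ev1: "eventually (\<lambda>n. sqrt (real n) \<ge> c) sequentially"
    by (simp add: filterlim_at_top)
  have "(\<lambda>n. (1 - c / sqrt (real n))\<^sup>2 * real d) \<longlonglongrightarrow> (1 - 0)\<^sup>2 * real d"
    by real_asymp
  then have ev2: "eventually (\<lambda>n. (1 - c / sqrt (real n))\<^sup>2 * real d > R) sequentially"
    using assms by (intro order_tendstoD) auto
  have "eventually (\<lambda>n. \<exists>s. s * s + 3 * C * s \<le> n \<and> real n * R \<le> real (s * s * d)) sequentially"
    using ev1 ev2 eventually_gt_at_top[of 0]
  proof eventually_elim
    case (elim n)
    define q where "q = nat \<lfloor>sqrt (real n)\<rfloor>"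
    have q: "real q \<le> sqrt (real n)" "sqrt (real n) < real q + 1"
      unfolding q_def by (simp_all add: of_nat_nat)
    then have "real q > real (2 * C)" using elim(1) by (simp add: c_def)
    then have "q > 2 * C" by linarith
    \<comment> \<open>The offset \<open>2 * C\<close> gives
      \<open>s * s + 3 * C * s \<le> (s + 2 * C)\<^sup>2 \<le> n\<close>; rounding the root accounts
      for the extra 1 in \<open>c\<close>.\<close>
    define s where "s = q - 2 * C"
    have q_s: "q = s + 2 * C" using \<open>q > 2 * C\<close> by (simp add: s_def)
    have "(real q)\<^sup>2 \<le> (sqrt (real n))\<^sup>2" using q by (intro power_mono) auto
    then have "q\<^sup>2 \<le> n" by (simp flip: of_nat_power)
    then have "s * s + 3 * C * s \<le> n"
      by (simp add: q_s power2_eq_square algebra_simps)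
    moreover have "real n * R \<le> real (s * s * d)"
    proof -
      have "real n * R \<le> real n * ((1 - c / sqrt (real n))\<^sup>2 * real d)"
        using elim(2) by (intro mult_left_mono) auto
      also have "\<dots> = (sqrt (real n) * (1 - c / sqrt (real n)))\<^sup>2 * real d"
        by (simp add: power_mult_distrib)
      also have "sqrt (real n) * (1 - c / sqrt (real n)) = sqrt (real n) - c"
        using elim(3) by (simp add: field_simps)
      also have "(sqrt (real n) - c)\<^sup>2 * real d \<le> (real s)\<^sup>2 * real d"
        using elim(1) q by (intro mult_right_mono power_mono) (auto simp: c_def q_s)
      finally show ?thesis by (simp add: power2_eq_square)
    qed
    ultimately show ?case by blast
  qed
  then show ?thesis by (simp add: eventually_sequentially)
qed

text \<open>A code with a single message is enough, as
  \<open>p powr (n * R) \<le> 1\<close>.\<close>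

lemma achievable_nonpos:
  assumes "R \<le> 0"
  shows "achievable_add C zrw zro zwo R"
  unfolding achievable_add_def
proof (intro allI impI exI conjI)
  fix \<epsilon> :: real and p n :: nat
  assume "\<epsilon> > 0" "prime p"
  let ?enc = "\<lambda>_ :: nat. return_pmf (\<lambda>_ _. 0) :: word pmf" and ?dec = "\<lambda>_ :: word. 0 :: nat"
  show "real p powr (real n * R) \<le> real 1"
  proof -
    have "real p powr (real n * R) \<le> real p powr 0"
      using prime_ge_1_nat[OF \<open>prime p\<close>] assms by (intro powr_mono) (auto simp: mult_nonneg_nonpos)
    then show ?thesis using prime_gt_0_nat[OF \<open>prime p\<close>] by simp
  qed
  show "valid_code p C n 1 ?enc"
    using prime_gt_0_nat[OF \<open>prime p\<close>] by (simp add: valid_code_def)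
  have msg: "msg_pmf (Suc 0) = return_pmf 0"
    by (simp add: msg_pmf_def pmf_of_set_singleton)
  show "error_prob_add p C n 1 ?enc ?dec E < \<epsilon>" for E
    using \<open>\<epsilon> > 0\<close> by (simp add: error_prob_add_def msg bind_return_pmf)
  show "secret C (zrw + zro) 1 ?enc"
    by (simp add: secret_def mutual_info_def msg bind_return_pmf)
qed

text \<open>Instantiates the scheme: the slots fit into \<open>n\<close> times, and the messages
  enumerate all arrays of \<open>s * s * (D - zr)\<close> symbols.\<close>

lemma hashed_sharing_code_exists:
  assumes "prime p" "C \<le> p" and less: "zwo + zro + 2 * zrw < C" and n: "s * s + 3 * C * s \<le> n"
  shows "\<exists>K enc dec. K = p ^ (s * s * (C - (zwo + zro + 2 * zrw))) \<and> valid_code p C n K enc \<and>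
    (\<forall>Zrw Zro Zwo E. admissible_adv C zrw zro zwo Zrw Zro Zwo E \<longrightarrow>
       error_prob_add p C n K enc dec E \<le> real (C * C) / real p) \<and>
    secret C (zrw + zro) K enc"
proof -
  define D zr where "D = C - (zrw + zwo)" and "zr = zrw + zro"
  have D_zr: "D - zr = C - (zwo + zro + 2 * zrw)" "zr < D" "D \<le> C"
    using less by (auto simp: D_def zr_def)
  obtain pos where pos: "inj_on pos (slots C s)" "pos ` slots C s \<subseteq> {..<n}"
    using card_le_inj[of "slots C s" "{..<n}"] finite_slots card_slots_le[of C s] n by auto
  define T where "T = ({..<s} \<times> {..<s} \<times> {..<D - zr}) \<rightarrow>\<^sub>E {..<p}"
  have fin_T: "finite T" unfolding T_def by (intro finite_PiE) auto
  have card_T: "card T = p ^ (s * s * (D - zr))"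
    by (simp add: T_def card_PiE card_cartesian_product mult.assoc)
  obtain g where g: "bij_betw g {0..<card T} T"
    using ex_bij_betw_nat_finite[OF fin_T] by blast
  have "p > 0" using assms(1) prime_gt_0_nat by blast
  interpret hashed_sharing p C n s zr D "card T" pos g
  proof
    show "card T \<ge> 1" using \<open>p > 0\<close> by (simp add: card_T)
    show "inj_on g {..<card T}" using g by (simp add: bij_betw_def atLeast0LessThan)
    show "g m \<in> ({..<s} \<times> {..<s} \<times> {..<D - zr}) \<rightarrow>\<^sub>E {..<p}" if "m < card T" for m
      using bij_betwE[OF g] that unfolding T_def[symmetric] by simp
    show "pos q < n" if "q \<in> slots C s" for q using pos(2) that by auto
  qed (fact assms(1) assms(2) D_zr(2) D_zr(3) pos(1))+
  have "error_prob_add p C n (card T) enc decoder E \<le> real (C * C) / real p"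
    if "admissible_adv C zrw zro zwo Zrw Zro Zwo E" for Zrw Zro Zwo E
    using that zr_def D_def by (rule error_prob_le)
  then show ?thesis
    using card_T valid_enc secret_enc unfolding D_zr(1)[symmetric] zr_def[symmetric]
    by (intro exI[of _ "card T"] exI[of _ enc] exI[of _ decoder]) blast
qed

text \<open>A large prime provides distinct evaluation points and pushes \<open>C * C / p\<close>
  below the error tolerance; only then is \<open>n\<close> taken large for the rate. If the bound is
  0, then \<open>R\<close> is negative.\<close>

lemma achievable_below:
  assumes "R < real (C - (zwo + zro + 2 * zrw))"
  shows "achievable_add C zrw zro zwo R"
proof (cases "zwo + zro + 2 * zrw < C")
  case False
  then show ?thesis using assms by (intro achievable_nonpos) simp
next
  case True
  define d where "d = C - (zwo + zro + 2 * zrw)"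
  show ?thesis
    unfolding achievable_add_def
  proof (intro allI impI)
    fix \<epsilon> :: real assume \<epsilon>: "\<epsilon> > 0"
    obtain p0 :: nat where p0: "real (C * C) / \<epsilon> < real p0"
      using reals_Archimedean2 by blast
    have "\<exists>N. \<forall>n\<ge>N. \<exists>K enc dec. real K \<ge> real p powr (real n * R) \<and> valid_code p C n K enc \<and>
           (\<forall>Zrw Zro Zwo E. admissible_adv C zrw zro zwo Zrw Zro Zwo E \<longrightarrow>
              error_prob_add p C n K enc dec E < \<epsilon>) \<and> secret C (zrw + zro) K enc"
      if p: "p \<ge> max C p0" "prime p" for p
    proof -
      have p1: "p \<ge> 1" using p(2) prime_ge_1_nat by blast
      have "real (C * C) / \<epsilon> < real p" using p0 p(1) by linarith
      then have err: "real (C * C) / real p < \<epsilon>"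
        using \<epsilon> p1 by (simp add: field_simps)
      obtain N where N: "\<And>n. n \<ge> N \<Longrightarrow> \<exists>s. s * s + 3 * C * s \<le> n \<and> real n * R \<le> real (s * s * d)"
        using square_block_fits[of R d C] assms unfolding d_def by blast
      show ?thesis
      proof (rule exI[of _ N], intro allI impI)
        fix n assume "n \<ge> N"
        then obtain s where s: "s * s + 3 * C * s \<le> n" "real n * R \<le> real (s * s * d)"
          using N by blast
        obtain K enc dec where K: "K = p ^ (s * s * d)"
          and code: "valid_code p C n K enc" "secret C (zrw + zro) K enc"
          and rel: "\<And>Zrw Zro Zwo E. admissible_adv C zrw zro zwo Zrw Zro Zwo E \<Longrightarrow>
            error_prob_add p C n K enc dec E \<le> real (C * C) / real p"
          using hashed_sharing_code_exists[OF p(2) _ True s(1)] p(1) unfolding d_def by auto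
        have "real p powr (real n * R) \<le> real p powr real (s * s * d)"
          using p1 s(2) by (intro powr_mono) auto
        also have "\<dots> = real K"
          using p1 by (simp add: K powr_realpow del: of_nat_mult)
        finally have "real p powr (real n * R) \<le> real K" .
        then show "\<exists>K enc dec. real K \<ge> real p powr (real n * R) \<and> valid_code p C n K enc \<and>
           (\<forall>Zrw Zro Zwo E. admissible_adv C zrw zro zwo Zrw Zro Zwo E \<longrightarrow>
              error_prob_add p C n K enc dec E < \<epsilon>) \<and> secret C (zrw + zro) K enc"
          using code le_less_trans[OF rel err] by blast
      qed
    qed
    then show "\<exists>p0. \<forall>p\<ge>p0. prime p \<longrightarrow> (\<exists>N. \<forall>n\<ge>N. \<exists>K enc dec.
           real K \<ge> real p powr (real n * R) \<and> valid_code p C n K enc \<and>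
           (\<forall>Zrw Zro Zwo E. admissible_adv C zrw zro zwo Zrw Zro Zwo E \<longrightarrow>
              error_prob_add p C n K enc dec E < \<epsilon>) \<and> secret C (zrw + zro) K enc)"
      by blast
  qed
qed

theorem theorem5:
  fixes C zrw zro zwo :: nat
  assumes "zrw + zro + zwo \<le> C"
  shows "Sup {R. achievable_add C zrw zro zwo R} =
    (if zwo + 2 * zrw < C
     then max 0 (real C - real (zwo + zro + 2 * zrw))
     else 0)"
proof -
  \<comment> \<open>Truncated subtraction merges both cases of the formula: it is 0 whenever
    \<open>zwo + 2 * zrw \<ge> C\<close>.\<close>
  have "Sup {R. achievable_add C zrw zro zwo R} = real (C - (zwo + zro + 2 * zrw))"
  proof (rule cSup_eq)
    fix R assume "R \<in> {R. achievable_add C zrw zro zwo R}"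
    then show "R \<le> real (C - (zwo + zro + 2 * zrw))"
      using achievable_le[OF assms] by simp
  next
    fix y assume y: "\<And>R. R \<in> {R. achievable_add C zrw zro zwo R} \<Longrightarrow> R \<le> y"
    show "real (C - (zwo + zro + 2 * zrw)) \<le> y"
      by (rule dense_le) (use y achievable_below in auto)
  qed
  then show ?thesis by auto
qed

end
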